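(* Let $0<q<1$, $a,b>0$, $ab<1$, $\nu>0$ and $\mu\in\mathbb{C}\setminus\mathbb{Z}_{\le0}$. Define the operator $$\bigl(A_{\nu,\mu}(a,b)f\bigr)(x)=\frac{(-bxq^\mu/a;q)_\infty}{(-bxq^{\mu-\nu}/a;q)_\infty}\sum_{k=0}^\infty f(xq^{\mu+k})\,(ab)^k\,\frac{(q^\nu,-xq^\mu;q)_k}{(q,-bxq^\mu/a;q)_k}\;{}_3\varphi_2\!\left(\begin{matrix}q^{-k},\,q^\mu,\,-bxq^{\mu-\nu}/a\\ q^{1-\nu-k},\,-xq^\mu\end{matrix};q,q\right)$$ for any bounded function $f$. Then $$\mathcal{L}^{(aq^\nu,bq^\mu)}\circ A_{\nu,\mu}(a,b)=A_{\nu,\mu}(a,b)\circ\mathcal{L}^{(a,b)}$$ on the space of functions compactly supported in $(0,\infty)$. Moreover, $$\bigl(A_{\nu,\mu}(a,b)\varphi_\lambda(\cdot;a,b;q)\bigr)(x)=\frac{(abq^{\nu+\mu};q)_\infty}{(ab;q)_\infty}\,\varphi_\lambda(x;aq^\nu,bq^\mu;q).$$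
   Context: $(x;q)_n=\prod_{k=0}^{n-1}(1-xq^k)$, $(x;q)_\infty=\prod_{k\ge0}(1-xq^k)$, $(x_1,\dots,x_m;q)_n=\prod_j(x_j;q)_n$. The terminating series is ${}_3\varphi_2\left(\begin{matrix}q^{-k},\alpha,\beta\\ \gamma,\delta\end{matrix};q,q\right)=\sum_{j=0}^k\frac{(q^{-k},\alpha,\beta;q)_j}{(q,\gamma,\delta;q)_j}q^j$. The operator $\mathcal{L}^{(a,b)}$ is $$(\mathcal{L}^{(a,b)}f)(x)=\frac a2\Bigl(1+\frac1x\Bigr)f(qx)-\Bigl(\frac a{2x}+\frac q{2bx}\Bigr)f(x)+\frac1{2a}\Bigl(1+\frac{aq}{bx}\Bigr)f(x/q).$$ The little $q$-Jacobi function is, for $\lambda=\frac12(\sigma+\sigma^{-1})$, $\sigma\in\mathbb{C}\setminus\{0\}$, $$\varphi_\lambda(x;a,b;q)={}_2\varphi_1\bigl(a\sigma,a/\sigma;ab;q,-bx/a\bigr),$$ where ${}_2\varphi_1(\alpha,\beta;\gamma;q,z)=\sum_{n\ge0}\frac{(\alpha,\beta;q)_n}{(q,\gamma;q)_n}z^n$ for $|z|<1$, continued meromorphically in $z$ (possible poles only at $z\in\{q^{-j}:j\ge0\}$). If $abq^{\nu+\mu}\in\{q^{-j}:j\geq 0\}$, the product $(abq^{\nu+\mu};q)_\infty\varphi_\lambda(x;aq^\nu,bq^\mu;q)$ is understood by continuity. Since $q^\mu$ may be non-real, functions are regarded as functions on $\mathbb{C}\setminus\{0\}$ (a function compactly supported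 in $(0,\infty)$ is one vanishing outside a compact subset of $(0,\infty)$), and the identities are pointwise identities at points $x\in\mathbb{C}\setminus\{0\}$ such that none of $-xq^\mu$, $-bxq^\mu/a$, $-bxq^{\mu-\nu}/a$ is an integer power of $q$; for real $\mu$ this includes all $x>0$. *)

theory Defs
  imports "HOL-Complex_Analysis.Complex_Analysis"
begin

definition qpoch :: "complex \<Rightarrow> real \<Rightarrow> nat \<Rightarrow> complex" where
  "qpoch x q n = (\<Prod>k<n. 1 - x * of_real q ^ k)"

definition qpoch_inf :: "complex \<Rightarrow> real \<Rightarrow> complex" where
  "qpoch_inf x q = (\<Prod>k. 1 - x * of_real q ^ k)"

text \<open>The powers \<open>q\<^sup>\<mu>\<close> for complex \<open>\<mu>\<close> are \<open>complex_of_real q powr \<mu>\<close>, which is \<open>exp (\<mu> ln q)\<close>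
  with the real logarithm of \<open>q > 0\<close>.\<close>

definition q_int_powers :: "real \<Rightarrow> complex set" where
  "q_int_powers q = range (\<lambda>n::int. of_real q powi n)"

definition q_neg_powers :: "real \<Rightarrow> complex set" where
  "q_neg_powers q = range (\<lambda>j::nat. 1 / of_real q ^ j)"

text \<open>The terminating series with upper parameters \<open>q\<^sup>-\<^sup>k, \<alpha>, \<beta>\<close>, lower parameters \<open>\<gamma>, \<delta>\<close>, and
  argument \<open>q\<close>.\<close>

definition phi32 :: "real \<Rightarrow> nat \<Rightarrow> complex \<Rightarrow> complex \<Rightarrow> complex \<Rightarrow> complex \<Rightarrow> complex" where
  "phi32 q k \<alpha> \<beta> \<gamma> \<delta> =
    (\<Sum>j\<le>k. (qpoch (1 / of_real q ^ k) q j * qpoch \<alpha> q j * qpoch \<beta> q j)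
        / (qpoch (of_real q) q j * qpoch \<gamma> q j * qpoch \<delta> q j) * of_real q ^ j)"

definition phi21_series :: "real \<Rightarrow> complex \<Rightarrow> complex \<Rightarrow> complex \<Rightarrow> complex \<Rightarrow> complex" where
  "phi21_series q \<alpha> \<beta> \<gamma> z =
    (\<Sum>n. (qpoch \<alpha> q n * qpoch \<beta> q n) / (qpoch (of_real q) q n * qpoch \<gamma> q n) * z ^ n)"

text \<open>The meromorphic continuation is determined by the series at every point off \<open>q_neg_powers q\<close>;
  the values on \<open>q_neg_powers q\<close> itself are unspecified.\<close>

definition phi21 :: "real \<Rightarrow> complex \<Rightarrow> complex \<Rightarrow> complex \<Rightarrow> complex \<Rightarrow> complex" where
  "phi21 q \<alpha> \<beta> \<gamma> =
    (SOME F. F meromorphic_on UNIV \<and> F holomorphic_on (- q_neg_powers q) \<and>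
       (\<forall>z. norm z < 1 \<longrightarrow> F z = phi21_series q \<alpha> \<beta> \<gamma> z))"

text \<open>Every complex \<open>\<lambda>\<close> has the form \<open>(\<sigma> + 1 / \<sigma>) / 2\<close>. The two choices of \<open>\<sigma>\<close> are inverse
  to each other and merely swap the upper parameters.\<close>

definition little_q_jacobi ::
    "real \<Rightarrow> complex \<Rightarrow> complex \<Rightarrow> complex \<Rightarrow> complex \<Rightarrow> complex" where
  "little_q_jacobi q lam a b x =
    (let \<sigma> = (SOME \<sigma>. \<sigma> \<noteq> 0 \<and> lam = (\<sigma> + 1 / \<sigma>) / 2)
     in phi21 q (a * \<sigma>) (a / \<sigma>) (a * b) (- b * x / a))"

text \<open>The product \<open>(ab;q)\<^sub>\<infinity> \<phi>\<^sub>\<lambda>(x;a,b;q)\<close>. If \<open>ab = q\<^sup>-\<^sup>j\<close>, the series is undefined and the product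
  is read as its continuous extension in the parameter \<open>b\<close>.\<close>

definition normalized_little_q_jacobi ::
    "real \<Rightarrow> complex \<Rightarrow> complex \<Rightarrow> complex \<Rightarrow> complex \<Rightarrow> complex" where
  "normalized_little_q_jacobi q lam a b x =
    (if a * b \<in> q_neg_powers q
     then Lim (at b) (\<lambda>b'. qpoch_inf (a * b') q * little_q_jacobi q lam a b' x)
     else qpoch_inf (a * b) q * little_q_jacobi q lam a b x)"

definition L_op ::
    "real \<Rightarrow> complex \<Rightarrow> complex \<Rightarrow> (complex \<Rightarrow> complex) \<Rightarrow> complex \<Rightarrow> complex" where
  "L_op q a b f x =
     a / 2 * (1 + 1 / x) * f (of_real q * x)
     - (a / (2 * x) + of_real q / (2 * b * x)) * f x
     + 1 / (2 * a) * (1 + a * of_real q / (b * x)) * f (x / of_real q)"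

definition A_summand ::
    "real \<Rightarrow> real \<Rightarrow> complex \<Rightarrow> real \<Rightarrow> real \<Rightarrow> (complex \<Rightarrow> complex) \<Rightarrow> complex \<Rightarrow> nat \<Rightarrow> complex" where
  "A_summand q \<nu> \<mu> a b f x k =
     f (x * of_real q powr (\<mu> + of_nat k)) * of_real (a * b) ^ k
     * (qpoch (of_real q powr of_real \<nu>) q k * qpoch (- x * of_real q powr \<mu>) q k)
     / (qpoch (of_real q) q k * qpoch (- of_real b * x * of_real q powr \<mu> / of_real a) q k)
     * phi32 q k
         (of_real q powr \<mu>)
         (- of_real b * x * of_real q powr (\<mu> - of_real \<nu>) / of_real a)
         (of_real q powr (1 - of_real \<nu> - of_nat k))
         (- x * of_real q powr \<mu>)"

definition A_op ::
    "real \<Rightarrow> real \<Rightarrow> complex \<Rightarrow> real \<Rightarrow> real \<Rightarrow> (complex \<Rightarrow> complex) \<Rightarrow> complex \<Rightarrow> complex" where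
  "A_op q \<nu> \<mu> a b f x =
     qpoch_inf (- of_real b * x * of_real q powr \<mu> / of_real a) q
     / qpoch_inf (- of_real b * x * of_real q powr (\<mu> - of_real \<nu>) / of_real a) q
     * (\<Sum>k. A_summand q \<nu> \<mu> a b f x k)"

text \<open>Functions on the punctured plane are represented by total functions whose value at \<open>0\<close> is
  irrelevant.\<close>

definition compactly_supported_pos :: "(complex \<Rightarrow> complex) \<Rightarrow> bool" where
  "compactly_supported_pos f \<longleftrightarrow>
     (\<exists>K. compact K \<and> K \<subseteq> complex_of_real ` {0<..} \<and> (\<forall>z. z \<noteq> 0 \<and> z \<notin> K \<longrightarrow> f z = 0))"

definition admissible_points :: "real \<Rightarrow> real \<Rightarrow> complex \<Rightarrow> real \<Rightarrow> real \<Rightarrow> complex set" where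
  "admissible_points q \<nu> \<mu> a b =
     {x. x \<noteq> 0 \<and>
         - x * of_real q powr \<mu> \<notin> q_int_powers q \<and>
         - of_real b * x * of_real q powr \<mu> / of_real a \<notin> q_int_powers q \<and>
         - of_real b * x * of_real q powr (\<mu> - of_real \<nu>) / of_real a \<notin> q_int_powers q}"

end

theory Submission
  imports Defs
begin

text \<open>Write \<open>t = q\<^sup>\<mu>\<close> and \<open>s = q\<^sup>\<nu>\<close>. The operator is a composition of two simpler ones,
\<open>A\<^sub>\<nu>\<^sub>,\<^sub>\<mu>(a,b) = A\<^sub>0\<^sub>,\<^sub>\<mu>(as,b) \<circ> A\<^sub>\<nu>\<^sub>,\<^sub>0(a,b)\<close>, where
\<open>(A\<^sub>0\<^sub>,\<^sub>\<mu>(a,b) f)(x) = \<Sum>j. (t)\<^sub>j/(q)\<^sub>j (ab)\<^sup>j f(xtq\<^sup>j)\<close> changes \<open>b\<close> into \<open>bt\<close> and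
\<open>(A\<^sub>\<nu>\<^sub>,\<^sub>0(a,b) f)(y) = \<Sum>m. (s)\<^sub>m/(q)\<^sub>m (ab)\<^sup>m (-y)\<^sub>m (-byq\<^sup>m/a)\<^sub>\<infinity>/(-by/(as))\<^sub>\<infinity> f(yq\<^sup>m)\<close> changes \<open>a\<close> into
\<open>as\<close>. Indeed the factors of the terminating series that contain \<open>q\<^sup>-\<^sup>k\<close> can be reversed, and then the
\<open>k\<close>-th term of \<open>A\<^sub>\<nu>\<^sub>,\<^sub>\<mu>\<close> is the sum over \<open>j + m = k\<close> of the terms of the composition
(\<open>phi32_weight\<close>, \<open>A_factorization\<close>). Both claims may therefore be checked for each factor.

The intertwining relations compare two series in the values of \<open>f\<close> along one orbit \<open>y q\<^sup>n\<close>. In both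
cases the contributions to each value cancel, so the partial sums of the difference telescope to a boundary
term, which is eventually \<open>0\<close> because \<open>f\<close> vanishes near the origin
(\<open>A_mu_intertwines\<close>, \<open>A_nu_intertwines\<close>).

For the eigenfunctions, put \<open>C(\<gamma>; z) = (\<gamma>)\<^sub>\<infinity> \<^sub>2\<phi>\<^sub>1(\<alpha>,\<beta>;\<gamma>;q,z)\<close>. The \<open>q\<close>-binomial theorem gives
\<open>\<Sum>j. (t)\<^sub>j/(q)\<^sub>j \<gamma>\<^sup>j C(\<gamma>; zq\<^sup>j) = C(\<gamma>t; z)\<close> (\<open>heine_cont_binomial_sum\<close>), which is the claim for
\<open>A\<^sub>0\<^sub>,\<^sub>\<mu>\<close>. Euler's transformation (\<open>heine_euler_transformation\<close>) replaces the argument \<open>-by/a\<close> by \<open>-y\<close>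
and the parameters \<open>a\<sigma>, a/\<sigma>\<close> by \<open>b/\<sigma>, b\<sigma>\<close>, on which \<open>A\<^sub>\<nu>\<^sub>,\<^sub>0\<close> has no effect; it turns \<open>A\<^sub>\<nu>\<^sub>,\<^sub>0\<close> into the same
sum with \<open>s\<close> for \<open>t\<close> (\<open>A_nu_eigenfunction\<close>).

Outside the unit disc all functions are governed by a second-order \<open>q\<close>-difference equation, which expresses
a value at \<open>z\<close> by the values at \<open>qz\<close> and \<open>q\<^sup>2z\<close>. It defines the continuation, and it carries
identities and regularity from a neighbourhood of \<open>0\<close> to the whole plane minus the poles
(\<open>q_descent\<close>). The factor \<open>(\<gamma>)\<^sub>\<infinity>\<close> makes \<open>C\<close> continuous in \<open>\<gamma>\<close>, so the exceptional values
\<open>\<gamma> = q\<^sup>-\<^sup>j\<close> are covered by the same formulas.\<close>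

section \<open>Series and orbits\<close>

text \<open>A double series dominated by a product of two summable sequences is absolutely
convergent, so summation by rows, by columns and by diagonals agree.\<close>

lemma double_series_rearrangement:
  fixes a :: "nat \<Rightarrow> nat \<Rightarrow> complex" and A B :: "nat \<Rightarrow> real"
  assumes bound: "\<And>j m. norm (a j m) \<le> A j * B m"
    and A: "summable A" "\<And>j. 0 \<le> A j" and B: "summable B" "\<And>m. 0 \<le> B m"
  shows "(\<lambda>m. \<Sum>j. a j m) sums (\<Sum>j. \<Sum>m. a j m)"
    and "(\<lambda>k. \<Sum>j\<le>k. a j (k - j)) sums (\<Sum>j. \<Sum>m. a j m)"
    and "summable (a j)" and "summable (\<lambda>j. \<Sum>m. a j m)"
proof -
  have row: "summable (\<lambda>m. norm (a j m))" for j
    by (rule summable_comparison_test'[of "\<lambda>m. A j * B m" 0])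
       (use bound B in \<open>auto intro: summable_mult\<close>)
  have col: "summable (\<lambda>j. norm (a j m))" for m
    by (rule summable_comparison_test'[of "\<lambda>j. A j * B m" 0])
       (use bound A in \<open>auto intro: summable_mult2\<close>)
  have A': "A summable_on UNIV" and B': "B summable_on UNIV"
    using A B by (auto intro!: norm_summable_imp_summable_on)
  have "(\<lambda>(j, m). A j * B m) summable_on (UNIV \<times> UNIV)"
  proof (rule summable_on_SigmaI)
    show "((\<lambda>m. case (j, m) of (j, m) \<Rightarrow> A j * B m) has_sum (A j * infsum B UNIV)) UNIV" for j
      using has_sum_cmult_right[OF has_sum_infsum[OF B'], of "A j"] by simp
    show "(\<lambda>j. A j * infsum B UNIV) summable_on UNIV"
      using A' by (rule summable_on_cmult_left)
  qed (use A B in auto)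
  hence "(\<lambda>p. norm (case p of (j, m) \<Rightarrow> a j m)) summable_on (UNIV \<times> UNIV)"
    by (rule summable_on_comparison_test) (use bound in auto)
  hence ab: "(\<lambda>(j, m). a j m) summable_on (UNIV \<times> UNIV)"
    by (rule abs_summable_summable)
  define S where "S = infsum (\<lambda>(j, m). a j m) (UNIV \<times> UNIV)"
  have S: "((\<lambda>(j, m). a j m) has_sum S) (UNIV \<times> UNIV)"
    using ab unfolding S_def by (rule has_sum_infsum)
  have rows: "((\<lambda>m. a j m) has_sum (\<Sum>m. a j m)) UNIV" for j
    by (rule norm_summable_imp_has_sum[OF row summable_sums[OF summable_norm_cancel[OF row]]])
  have cols: "((\<lambda>j. a j m) has_sum (\<Sum>j. a j m)) UNIV" for m
    by (rule norm_summable_imp_has_sum[OF col summable_sums[OF summable_norm_cancel[OF col]]])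
  have "((\<lambda>j. \<Sum>m. a j m) has_sum S) UNIV"
    by (rule has_sum_Sigma'[OF S]) (use rows in simp)
  hence "(\<lambda>j. \<Sum>m. a j m) sums S"
    by (rule has_sum_imp_sums)
  hence eq: "S = (\<Sum>j. \<Sum>m. a j m)" and "summable (\<lambda>j. \<Sum>m. a j m)"
    by (auto simp: sums_iff)
  thus "summable (\<lambda>j. \<Sum>m. a j m)" by simp
  have "((\<lambda>(m, j). a j m) has_sum S) (UNIV \<times> UNIV)"
    using S by (subst has_sum_swap) (simp add: case_prod_unfold)
  hence "((\<lambda>m. \<Sum>j. a j m) has_sum S) UNIV"
    by (rule has_sum_Sigma') (use cols in simp)
  thus "(\<lambda>m. \<Sum>j. a j m) sums (\<Sum>j. \<Sum>m. a j m)"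
    unfolding eq[symmetric] by (rule has_sum_imp_sums)
  have "((\<lambda>(k, j). a j (k - j)) has_sum S) (SIGMA k:UNIV. {..k})"
    using S
    by (subst has_sum_reindex_bij_witness[of _ "\<lambda>(j, m). (j + m, j)" "\<lambda>(k, j). (j, k - j)"
          "UNIV \<times> UNIV" "\<lambda>(j, m). a j m" _ S S]) auto
  hence "((\<lambda>k. \<Sum>j\<le>k. a j (k - j)) has_sum S) UNIV"
    by (rule has_sum_Sigma') (auto intro: has_sum_finite)
  thus "(\<lambda>k. \<Sum>j\<le>k. a j (k - j)) sums (\<Sum>j. \<Sum>m. a j m)"
    unfolding eq[symmetric] by (rule has_sum_imp_sums)
  show "summable (a j)"
    by (rule summable_norm_cancel[OF row])
qed

text \<open>When an operator of the form \<open>f(x) \<mapsto> \<Sum>j. e\<^sub>j f(xq\<^sup>j)\<close> is compared with a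
three-term difference operator, the value \<open>u (n + 2)\<close> receives contributions from the terms \<open>n\<close>, \<open>n + 1\<close>
and \<open>n + 2\<close> of the series. The hypotheses say that these cancel, which leaves the incomplete contributions
at the upper end.\<close>

lemma three_term_telescope:
  fixes p r s u :: "nat \<Rightarrow> complex"
  assumes "s 0 = 0" and "r 0 + s 1 = 0" and "\<And>n. p n + r (Suc n) + s (n + 2) = 0"
  shows "(\<Sum>j\<le>n. p j * u (j + 2) + r j * u (j + 1) + s j * u j) =
    p n * u (n + 2) - s (n + 1) * u (n + 1)"
proof (induction n)
  case 0
  have "r 0 = - s 1" using assms(2) by (simp add: add_eq_0_iff2)
  thus ?case using assms(1) by simp
next
  case (Suc n)
  have r: "r (Suc n) = - p n - s (n + 2)" using assms(3)[of n] by (simp add: algebra_simps add_eq_0_iff)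
  have "(\<Sum>j\<le>Suc n. p j * u (j + 2) + r j * u (j + 1) + s j * u j) =
    (p n * u (n + 2) - s (n + 1) * u (n + 1)) +
    (p (Suc n) * u (Suc n + 2) + r (Suc n) * u (n + 2) + s (Suc n) * u (Suc n))"
    by (subst sum.atMost_Suc, subst Suc.IH) simp
  also have "\<dots> = p (Suc n) * u (Suc n + 2) - s (Suc n + 1) * u (Suc n + 1)"
    unfolding r by (simp add: algebra_simps)
  finally show ?case .
qed

lemma three_term_telescope_sums:
  fixes p r s u :: "nat \<Rightarrow> complex"
  assumes "s 0 = 0" and "r 0 + s 1 = 0" and "\<And>n. p n + r (Suc n) + s (n + 2) = 0"
    and "(\<lambda>n. p n * u (n + 2) - s (n + 1) * u (n + 1)) \<longlonglongrightarrow> 0"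
  shows "(\<lambda>j. p j * u (j + 2) + r j * u (j + 1) + s j * u j) sums 0"
  unfolding sums_def_le three_term_telescope[OF assms(1-3)] by (rule assms(4))

lemma bounded_coeff_summable:
  fixes c :: "nat \<Rightarrow> complex"
  assumes "\<And>n. norm (c n) \<le> M" and "norm z < 1"
  shows "summable (\<lambda>n. norm (c n * z ^ n))" and "summable (\<lambda>n. c n * z ^ n)"
proof -
  show "summable (\<lambda>n. norm (c n * z ^ n))"
    by (rule summable_comparison_test'[of "\<lambda>n. M * norm z ^ n" 0])
       (use assms in \<open>auto simp: norm_mult norm_power intro!: summable_mult summable_geometric
          mult_right_mono\<close>)
  thus "summable (\<lambda>n. c n * z ^ n)" by (rule summable_norm_cancel)
qed

lemma bounded_coeff_isCont_0:
  fixes c :: "nat \<Rightarrow> complex"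
  assumes "\<And>n. norm (c n) \<le> M"
  shows "isCont (\<lambda>z. \<Sum>n. c n * z ^ n) 0"
  by (rule isCont_powser[of _ "1/2"]) (use bounded_coeff_summable(2)[of c M "1/2"] assms in \<open>auto simp: norm_divide\<close>)

lemma summable_of_eventually_zero:
  fixes c u :: "nat \<Rightarrow> complex"
  assumes "\<And>n. n \<ge> N \<Longrightarrow> u n = 0"
  shows "summable (\<lambda>n. c n * u (n + k))"
  by (rule summable_finite[of "{..<N}"]) (use assms in auto)

lemma eventually_zero_bounded:
  fixes h :: "nat \<Rightarrow> complex"
  assumes "\<exists>N. \<forall>n\<ge>N. h n = 0"
  shows "\<exists>F. \<forall>n. norm (h n) \<le> F"
proof -
  have "h \<longlonglongrightarrow> 0"
    using assms by (intro tendsto_eventually) (auto simp: eventually_sequentially)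
  hence "Bseq h" by (intro convergent_imp_Bseq convergentI)
  thus ?thesis unfolding Bseq_def by auto
qed

lemma analytic_on_scaled:
  assumes "f analytic_on {z * c}" shows "(\<lambda>w. f (w * c)) analytic_on {z :: complex}"
  using analytic_on_compose_gen[of "\<lambda>w. w * c" "{z}" f "{z * c}"] assms
  by (simp add: o_def analytic_on_mult analytic_on_ident analytic_on_const)

text \<open>Every \<open>lam\<close> is attained, so the choice of \<open>\<sigma>\<close> in the definition of the little
\<open>q\<close>-Jacobi function is a genuine one.\<close>

lemma joukowski_parameter_exists: "\<exists>\<sigma>::complex. \<sigma> \<noteq> 0 \<and> lam = (\<sigma> + 1 / \<sigma>) / 2"
proof -
  define \<sigma> where "\<sigma> = lam + csqrt (lam ^ 2 - 1)"
  have *: "\<sigma> * (2 * lam - \<sigma>) = 1"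
    using power2_csqrt[of "lam ^ 2 - 1"]
    by (simp add: \<sigma>_def algebra_simps power2_eq_square)
  hence "\<sigma> \<noteq> 0" by auto
  moreover have "1 / \<sigma> = 2 * lam - \<sigma>" using * \<open>\<sigma> \<noteq> 0\<close> by (simp add: field_simps)
  ultimately show ?thesis by (intro exI[of _ \<sigma>]) simp
qed

section \<open>Shifted factorials and the \<open>q\<close>-binomial theorem\<close>

text \<open>With the base fixed, shifted factorials can be written without it, and the exceptional values
of an argument or a lower parameter are the points \<open>q\<^sup>-\<^sup>j\<close>, called \<open>poles\<close> below.\<close>

locale q_base =
  fixes q :: real
  assumes q_pos: "0 < q" and q_less_1: "q < 1"
begin

abbreviation "Q \<equiv> complex_of_real q"
abbreviation "poch x n \<equiv> qpoch x q n"
abbreviation "poch_inf x \<equiv> qpoch_inf x q"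
abbreviation "poles \<equiv> q_neg_powers q"

lemma q_nonzero [simp]: "q \<noteq> 0"
  using q_pos by simp

lemma abs_q [simp]: "\<bar>q\<bar> = q"
  using q_pos by simp

lemma Q_power_neq_1: "n > 0 \<Longrightarrow> Q ^ n \<noteq> 1"
proof
  assume "n > 0" "Q ^ n = 1"
  hence "norm (Q ^ n) = 1" by simp
  hence "q ^ n = 1" by (simp add: norm_power)
  moreover have "q ^ n < 1" using q_pos q_less_1 \<open>n > 0\<close> by (simp add: power_less_one_iff)
  ultimately show False by simp
qed

lemma Q_powers_tendsto_0: "(\<lambda>n. Q ^ n) \<longlonglongrightarrow> 0"
  using q_pos q_less_1 by (intro LIMSEQ_power_zero) simp

lemma norm_mult_Q_power_le: "norm (x * Q ^ n) \<le> norm x"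
  using q_pos q_less_1 by (simp add: norm_mult norm_power mult_left_le power_le_one)

lemma poles_eq: "x \<in> poles \<longleftrightarrow> (\<exists>j. x * Q ^ j = 1)"
proof -
  have "x \<in> poles \<longleftrightarrow> (\<exists>j. x = 1 / Q ^ j)" by (auto simp: q_neg_powers_def)
  thus ?thesis by (simp add: eq_divide_eq)
qed

lemma mult_Q_notin_poles: "x \<notin> poles \<Longrightarrow> x * Q \<notin> poles"
  unfolding poles_eq by (metis mult.assoc power_Suc)

lemma mult_Q_power_notin_poles: "x \<notin> poles \<Longrightarrow> x * Q ^ n \<notin> poles"
  unfolding poles_eq by (metis mult.assoc power_add)

lemma zero_notin_poles [simp]: "0 \<notin> poles"
  unfolding poles_eq by simp

lemma one_in_poles [simp]: "1 \<in> poles"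
  unfolding poles_eq by (auto intro: exI[of _ 0])

lemma norm_less_1_notin_poles: "norm x < 1 \<Longrightarrow> x \<notin> poles"
proof
  assume "norm x < 1" "x \<in> poles"
  then obtain j where "x * Q ^ j = 1" unfolding poles_eq by auto
  hence "norm (x * Q ^ j) = 1" by simp
  thus False using norm_mult_Q_power_le[of x j] \<open>norm x < 1\<close> by simp
qed

lemma poch_0 [simp]: "poch x 0 = 1"
  by (simp add: qpoch_def)

lemma poch_Suc: "poch x (Suc n) = poch x n * (1 - x * Q ^ n)"
  by (simp add: qpoch_def)

lemma poch_add: "poch x (m + n) = poch x m * poch (x * Q ^ m) n"
  by (induction n) (simp_all add: poch_Suc power_add algebra_simps)

lemma poch_Suc_shift: "poch x (Suc n) = (1 - x) * poch (x * Q) n"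
  using poch_add[of x 1 n] by (simp add: qpoch_def)

lemma poch_nonzero: "x \<notin> poles \<Longrightarrow> poch x n \<noteq> 0"
  unfolding poles_eq qpoch_def by auto

lemma Q_notin_poles [simp]: "Q \<notin> poles"
  using q_less_1 by (intro norm_less_1_notin_poles) simp

lemma poch_Q_nonzero [simp]: "poch Q n \<noteq> 0"
  by (rule poch_nonzero) simp

lemma convergent_prod_poch: "convergent_prod (\<lambda>k. 1 - x * Q ^ k)"
proof -
  have "summable (\<lambda>k. norm x * q ^ k)"
    using q_pos q_less_1 by (intro summable_mult summable_geometric) simp
  hence "summable (\<lambda>k. norm ((1 - x * Q ^ k) - 1))"
    by (simp add: norm_mult norm_power)
  hence "abs_convergent_prod (\<lambda>k. 1 - x * Q ^ k)"
    by (rule summable_imp_abs_convergent_prod)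
  thus ?thesis by (rule abs_convergent_prod_imp_convergent_prod)
qed

lemma poch_tendsto: "(\<lambda>n. poch x n) \<longlonglongrightarrow> poch_inf x"
  using convergent_prod_LIMSEQ[OF convergent_prod_poch[of x]]
  unfolding qpoch_def qpoch_inf_def LIMSEQ_lessThan_iff_atMost .

text \<open>Passing to the limit in the splitting of finite shifted factorials also covers the case of
vanishing factors.\<close>

lemma poch_inf_split: "poch_inf x = poch x n * poch_inf (x * Q ^ n)"
proof -
  have "(\<lambda>k. poch x (n + k)) \<longlonglongrightarrow> poch_inf x"
    using LIMSEQ_ignore_initial_segment[OF poch_tendsto[of x], of n] by (simp add: add.commute)
  moreover have "(\<lambda>k. poch x (n + k)) \<longlonglongrightarrow> poch x n * poch_inf (x * Q ^ n)"
    unfolding poch_add by (intro tendsto_intros poch_tendsto)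
  ultimately show ?thesis by (rule LIMSEQ_unique)
qed

lemma poch_inf_step: "poch_inf x = (1 - x) * poch_inf (x * Q)"
  using poch_inf_split[of x 1] by (simp add: qpoch_def)

lemma poch_inf_0 [simp]: "poch_inf 0 = 1"
  by (simp add: qpoch_inf_def)

lemma poch_inf_eq_0_iff: "poch_inf x = 0 \<longleftrightarrow> x \<in> poles"
proof
  assume "poch_inf x = 0"
  thus "x \<in> poles"
    using prodinf_nonzero[OF convergent_prod_poch[of x]]
    unfolding poles_eq qpoch_inf_def by auto
next
  assume "x \<in> poles"
  then obtain j where "x * Q ^ j = 1" unfolding poles_eq by auto
  hence "poch x (Suc j) = 0" by (simp add: poch_Suc)
  thus "poch_inf x = 0" using poch_inf_split[of x "Suc j"] by simp
qed

lemma poch_inf_holomorphic: "poch_inf holomorphic_on UNIV"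
proof (rule holomorphic_uniform_sequence[where f = "\<lambda>n x. poch x n"])
  show "(\<lambda>x. poch x n) holomorphic_on UNIV" for n
    unfolding qpoch_def by (intro holomorphic_intros)
  have "uniform_limit (cball x 1) (\<lambda>n x. poch x n) poch_inf sequentially" for x
  proof -
    have "uniformly_convergent_on (cball x 1) (\<lambda>N y. \<Prod>k<N. 1 + (- (y * Q ^ k)))"
    proof (rule uniformly_convergent_on_prod)
      show "uniformly_convergent_on (cball x 1) (\<lambda>N y. \<Sum>k<N. norm (- (y * Q ^ k)))"
      proof (rule Weierstrass_m_test')
        show "norm (norm (- (y * Q ^ k))) \<le> (norm x + 1) * q ^ k" if "y \<in> cball x 1" for k y
        proof -
          have "norm y \<le> norm x + 1"
            using that norm_triangle_sub[of y x] by (simp add: dist_norm norm_minus_commute)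
          thus ?thesis using q_pos by (simp add: norm_mult norm_power mult_right_mono)
        qed
        show "summable (\<lambda>k. (norm x + 1) * q ^ k)"
          using q_pos q_less_1 by (intro summable_mult summable_geometric) simp
      qed
    qed (auto intro!: continuous_intros)
    hence "uniformly_convergent_on (cball x 1) (\<lambda>n x. poch x n)"
      by (simp add: qpoch_def)
    then obtain l where l: "uniform_limit (cball x 1) (\<lambda>n x. poch x n) l sequentially"
      by (auto simp: uniformly_convergent_on_def)
    have "l y = poch_inf y" if "y \<in> cball x 1" for y
      using LIMSEQ_unique[OF tendsto_uniform_limitI[OF l that] poch_tendsto] .
    thus ?thesis using uniform_limit_cong'[of "cball x 1" "\<lambda>n x. poch x n" "\<lambda>n x. poch x n" l poch_inf] l
      by auto
  qed
  thus "\<exists>d>0. cball x d \<subseteq> UNIV \<and> uniform_limit (cball x d) (\<lambda>n x. poch x n) poch_inf sequentially" for x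
    by (intro exI[of _ 1]) auto
qed simp

lemma continuous_poch_inf: "continuous_on UNIV poch_inf"
  using poch_inf_holomorphic by (rule holomorphic_on_imp_continuous_on)

lemma poch_inf_bounded:
  obtains M where "M > 0" and "\<And>x. norm x \<le> R \<Longrightarrow> norm (poch_inf x) \<le> M"
proof -
  have "bounded (poch_inf ` cball 0 R)"
    by (intro compact_imp_bounded compact_continuous_image
        continuous_on_subset[OF continuous_poch_inf]) auto
  then obtain M where "M > 0" "\<forall>y \<in> poch_inf ` cball 0 R. norm y \<le> M"
    unfolding bounded_pos by auto
  thus ?thesis using that[of M] by auto
qed

lemma poch_bounded:
  obtains M where "M > 0" and "\<And>n. norm (poch x n) \<le> M"
proof -
  have "Bseq (\<lambda>n. poch x n)"
    using poch_tendsto by (intro convergent_imp_Bseq convergentI)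
  thus ?thesis using that unfolding Bseq_def by auto
qed

lemma inverse_poch_bounded:
  assumes "x \<notin> poles"
  obtains M where "M > 0" and "\<And>n. norm (1 / poch x n) \<le> M"
proof -
  have "(\<lambda>n. 1 / poch x n) \<longlonglongrightarrow> 1 / poch_inf x"
    using assms poch_inf_eq_0_iff by (intro tendsto_intros poch_tendsto) auto
  hence "Bseq (\<lambda>n. 1 / poch x n)" by (intro convergent_imp_Bseq convergentI)
  thus ?thesis using that unfolding Bseq_def by auto
qed

text \<open>Both factorials converge and the limit of the denominator is not \<open>0\<close>.\<close>

lemma poch_ratio_bounded:
  assumes "y \<notin> poles"
  obtains M where "M > 0" and "\<And>n. norm (poch x n / poch y n) \<le> M"
proof -
  obtain M where M: "M > 0" "\<And>n. norm (poch x n) \<le> M" using poch_bounded by blast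
  obtain M' where M': "M' > 0" "\<And>n. norm (1 / poch y n) \<le> M'"
    using inverse_poch_bounded[OF assms] by blast
  have "norm (poch x n / poch y n) \<le> M * M'" for n
    using mult_mono[OF M(2) M'(2), of n n] M M' by (simp add: norm_divide)
  thus ?thesis using that[of "M * M'"] M M' by simp
qed

definition binom_coeff :: "complex \<Rightarrow> nat \<Rightarrow> complex" where
  "binom_coeff t j = poch t j / poch Q j"

lemma binom_coeff_0 [simp]: "binom_coeff t 0 = 1"
  by (simp add: binom_coeff_def)

lemma binom_coeff_Suc: "binom_coeff t (Suc j) * (1 - Q ^ Suc j) = binom_coeff t j * (1 - t * Q ^ j)"
  using Q_power_neq_1[of "Suc j"] by (simp add: binom_coeff_def poch_Suc field_simps)

lemma binom_coeff_power_Suc: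
  "binom_coeff t (Suc j) * c ^ Suc j * (1 - Q ^ Suc j) = binom_coeff t j * c ^ j * (c * (1 - t * Q ^ j))"
proof -
  have "binom_coeff t (Suc j) * c ^ Suc j * (1 - Q ^ Suc j) =
    c ^ Suc j * (binom_coeff t (Suc j) * (1 - Q ^ Suc j))"
    by (simp only: mult_ac)
  thus ?thesis unfolding binom_coeff_Suc by (simp add: mult_ac)
qed

lemma binom_coeff_bounded:
  obtains M where "M > 0" and "\<And>n. norm (binom_coeff t n) \<le> M"
  using poch_ratio_bounded[of Q t] unfolding binom_coeff_def by auto

text \<open>The sum \<open>f(z)\<close> satisfies \<open>(1 - z) f(z) = (1 - tz) f(zq)\<close> by the recursion for the
coefficients. Iterating this \<open>n\<close> times gives \<open>(z)\<^sub>n f(z) = (tz)\<^sub>n f(zq\<^sup>n)\<close>, and \<open>f\<close> is continuous at \<open>0\<close>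
with value \<open>1\<close>.\<close>

theorem q_binomial:
  assumes "norm z < 1"
  shows "(\<lambda>j. binom_coeff t j * z ^ j) sums (poch_inf (t * z) / poch_inf z)"
proof -
  obtain M where M: "\<And>n. norm (binom_coeff t n) \<le> M" using binom_coeff_bounded by blast
  define f where "f = (\<lambda>z. \<Sum>j. binom_coeff t j * z ^ j)"
  have sums: "(\<lambda>j. binom_coeff t j * w ^ j) sums f w" if "norm w < 1" for w
    unfolding f_def using bounded_coeff_summable(2)[of "binom_coeff t" M w] M that by auto
  have small: "norm (z * Q ^ n) < 1" for n
    using norm_mult_Q_power_le[of z n] assms by simp
  have step: "(1 - w) * f w = (1 - t * w) * f (w * Q)" if "norm w < 1" for w
  proof -
    have w': "norm (w * Q) < 1" using norm_mult_Q_power_le[of w 1] that by simp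
    have "(\<lambda>j. binom_coeff t j * w ^ j - binom_coeff t j * (w * Q) ^ j) sums (f w - f (w * Q))"
      using that w' by (intro sums_diff sums)
    hence "(\<lambda>j. binom_coeff t (Suc j) * w ^ Suc j - binom_coeff t (Suc j) * (w * Q) ^ Suc j)
      sums (f w - f (w * Q))"
      by (subst sums_Suc_iff) simp
    also have "(\<lambda>j. binom_coeff t (Suc j) * w ^ Suc j - binom_coeff t (Suc j) * (w * Q) ^ Suc j) =
      (\<lambda>j. w * (binom_coeff t j * w ^ j - t * (binom_coeff t j * (w * Q) ^ j)))"
    proof
      fix j
      have "binom_coeff t (Suc j) * w ^ Suc j - binom_coeff t (Suc j) * (w * Q) ^ Suc j =
        w ^ Suc j * (binom_coeff t (Suc j) * (1 - Q ^ Suc j))"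
        by (simp add: algebra_simps power_mult_distrib)
      also have "\<dots> = w ^ Suc j * (binom_coeff t j * (1 - t * Q ^ j))"
        by (simp only: binom_coeff_Suc)
      finally show "binom_coeff t (Suc j) * w ^ Suc j - binom_coeff t (Suc j) * (w * Q) ^ Suc j =
        w * (binom_coeff t j * w ^ j - t * (binom_coeff t j * (w * Q) ^ j))"
        by (simp add: algebra_simps power_mult_distrib)
    qed
    finally have "f w - f (w * Q) = w * (f w - t * f (w * Q))"
      by (rule sums_unique2) (intro sums_mult sums_diff sums that w')
    thus ?thesis by (simp add: algebra_simps)
  qed
  have "poch z n * f z = poch (t * z) n * f (z * Q ^ n)" for n
  proof (induction n)
    case (Suc n)
    have "poch z (Suc n) * f z = (1 - z * Q ^ n) * (poch z n * f z)"
      by (simp add: poch_Suc)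
    also have "\<dots> = poch (t * z) n * ((1 - z * Q ^ n) * f (z * Q ^ n))"
      unfolding Suc.IH by (simp only: mult_ac)
    also have "\<dots> = poch (t * z) (Suc n) * f (z * Q ^ Suc n)"
      using step[OF small] by (simp add: poch_Suc mult_ac)
    finally show ?case .
  qed simp
  moreover have "(\<lambda>n. poch z n * f z) \<longlonglongrightarrow> poch_inf z * f z"
    by (intro tendsto_intros poch_tendsto)
  moreover have "(\<lambda>n. poch (t * z) n * f (z * Q ^ n)) \<longlonglongrightarrow> poch_inf (t * z) * f 0"
  proof (intro tendsto_mult poch_tendsto)
    have "isCont f 0" unfolding f_def using bounded_coeff_isCont_0 M by blast
    moreover have "(\<lambda>n. z * Q ^ n) \<longlonglongrightarrow> 0"
      using tendsto_mult[OF tendsto_const Q_powers_tendsto_0] by simp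
    ultimately show "(\<lambda>n. f (z * Q ^ n)) \<longlonglongrightarrow> f 0" by (rule isCont_tendsto_compose)
  qed
  ultimately have "poch_inf z * f z = poch_inf (t * z) * f 0"
    using LIMSEQ_unique by auto
  moreover have "f 0 = 1"
    unfolding f_def by (subst powser_zero) simp
  moreover have "poch_inf z \<noteq> 0"
    using norm_less_1_notin_poles[OF assms] poch_inf_eq_0_iff by blast
  ultimately have "f z = poch_inf (t * z) / poch_inf z" by (simp add: field_simps)
  thus ?thesis using sums[OF assms] by simp
qed

section \<open>The continuation of the hypergeometric series\<close>

lemma small_q_power:
  assumes "r > 0"
  obtains n where "norm (z :: complex) * q ^ n < r"
proof -
  have "(\<lambda>n. norm z * q ^ n) \<longlonglongrightarrow> norm z * 0"
    using q_pos q_less_1 by (intro tendsto_intros LIMSEQ_power_zero) simp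
  hence "eventually (\<lambda>n. norm z * q ^ n < r) sequentially"
    using order_tendstoD(2)[of "\<lambda>n. norm z * q ^ n" 0 sequentially r] assms by simp
  thus ?thesis using that by (auto simp: eventually_sequentially)
qed

text \<open>A property that passes from \<open>zq\<close> and \<open>zq\<^sup>2\<close> to \<open>z\<close> needs to be known only near \<open>0\<close>. This
is the means by which second-order \<open>q\<close>-difference equations are used.\<close>

lemma q_descent:
  assumes "r > 0" and "R z"
    and R: "\<And>z. R z \<Longrightarrow> R (z * Q)"
    and small: "\<And>z. R z \<Longrightarrow> norm z < r \<Longrightarrow> P z"
    and step: "\<And>z. R z \<Longrightarrow> P (z * Q) \<Longrightarrow> P (z * Q ^ 2) \<Longrightarrow> P z"
  shows "P z"
proof -
  have ind: "R z \<Longrightarrow> norm z * q ^ n < r \<Longrightarrow> P z" for n z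
  proof (induction n arbitrary: z)
    case 0
    thus ?case using small by simp
  next
    case (Suc n)
    have "norm (z * Q) * q ^ n < r"
      using Suc.prems(2) by (simp add: norm_mult mult_ac)
    moreover have "norm (z * Q ^ 2) * q ^ n \<le> norm z * q ^ Suc n"
      using q_pos q_less_1 mult_left_le[of q "norm z * q ^ Suc n"]
      by (simp add: norm_mult norm_power power2_eq_square mult_ac)
    ultimately have "P (z * Q)" "P (z * Q ^ 2)"
      using Suc.IH[of "z * Q"] Suc.IH[of "z * Q ^ 2"] Suc.prems R[of z] R[of "z * Q"]
      by (auto simp: power2_eq_square mult.assoc)
    thus ?case using step Suc.prems by blast
  qed
  obtain n where "norm z * q ^ n < r"
    using small_q_power[OF \<open>r > 0\<close>] .
  thus ?thesis using ind \<open>R z\<close> by blast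
qed

text \<open>The coefficient of \<open>\<^sub>2\<phi>\<^sub>1\<close> multiplied by \<open>(\<gamma>)\<^sub>\<infinity>\<close>. The quotient \<open>(\<gamma>)\<^sub>\<infinity> / (\<gamma>)\<^sub>n\<close> is written as
\<open>(\<gamma>q\<^sup>n)\<^sub>\<infinity>\<close>, which is defined and continuous for every \<open>\<gamma>\<close>.\<close>

definition heine_coeff :: "complex \<Rightarrow> complex \<Rightarrow> complex \<Rightarrow> nat \<Rightarrow> complex" where
  "heine_coeff \<alpha> \<beta> \<gamma> n = poch \<alpha> n * poch \<beta> n * poch_inf (\<gamma> * Q ^ n) / poch Q n"

definition heine_series :: "complex \<Rightarrow> complex \<Rightarrow> complex \<Rightarrow> complex \<Rightarrow> complex" where
  "heine_series \<alpha> \<beta> \<gamma> z = (\<Sum>n. heine_coeff \<alpha> \<beta> \<gamma> n * z ^ n)"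

lemma heine_coeff_Suc:
  "heine_coeff \<alpha> \<beta> \<gamma> (Suc n) * ((1 - Q ^ Suc n) * (1 - \<gamma> * Q ^ n)) =
   heine_coeff \<alpha> \<beta> \<gamma> n * ((1 - \<alpha> * Q ^ n) * (1 - \<beta> * Q ^ n))"
proof -
  have nz: "1 - Q ^ Suc n \<noteq> 0" using Q_power_neq_1[of "Suc n"] by simp
  have inf: "poch_inf (\<gamma> * Q ^ n) = (1 - \<gamma> * Q ^ n) * poch_inf (\<gamma> * Q ^ Suc n)"
    using poch_inf_step[of "\<gamma> * Q ^ n"] by (simp add: mult_ac)
  have "poch Q (Suc n) = poch Q n * (1 - Q ^ Suc n)" by (simp add: poch_Suc)
  hence "heine_coeff \<alpha> \<beta> \<gamma> (Suc n) * ((1 - Q ^ Suc n) * (1 - \<gamma> * Q ^ n)) =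
    poch \<alpha> (Suc n) * poch \<beta> (Suc n) * poch_inf (\<gamma> * Q ^ n) / poch Q n"
    unfolding heine_coeff_def inf using nz by (simp del: power_Suc)
  thus ?thesis by (simp add: heine_coeff_def poch_Suc mult_ac)
qed

text \<open>The bound is uniform in \<open>\<gamma>\<close>, as is needed for continuity in \<open>\<gamma>\<close>.\<close>

lemma heine_coeff_bounded:
  "\<exists>M>0. \<forall>\<gamma> n. norm \<gamma> \<le> R \<longrightarrow> norm (heine_coeff \<alpha> \<beta> \<gamma> n) \<le> M"
proof -
  obtain M1 where M1: "M1 > 0" "\<And>n. norm (poch \<alpha> n) \<le> M1" using poch_bounded by blast
  obtain M2 where M2: "M2 > 0" "\<And>n. norm (poch \<beta> n / poch Q n) \<le> M2"
    using poch_ratio_bounded[of Q \<beta>] by auto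
  obtain M3 where M3: "M3 > 0" "\<And>x. norm x \<le> R \<Longrightarrow> norm (poch_inf x) \<le> M3"
    using poch_inf_bounded by blast
  have "norm (heine_coeff \<alpha> \<beta> \<gamma> n) \<le> M1 * M2 * M3" if "norm \<gamma> \<le> R" for \<gamma> n
  proof -
    have "norm (\<gamma> * Q ^ n) \<le> R" using norm_mult_Q_power_le[of \<gamma> n] that by linarith
    hence "norm (poch \<alpha> n) * norm (poch \<beta> n / poch Q n) * norm (poch_inf (\<gamma> * Q ^ n)) \<le> M1 * M2 * M3"
      using M1 M2 M3 by (intro mult_mono) auto
    thus ?thesis by (simp add: heine_coeff_def norm_mult norm_divide)
  qed
  thus ?thesis using M1 M2 M3 by (intro exI[of _ "M1 * M2 * M3"]) auto
qed

lemma heine_series_sums: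
  assumes "norm z < 1"
  shows "(\<lambda>n. heine_coeff \<alpha> \<beta> \<gamma> n * z ^ n) sums heine_series \<alpha> \<beta> \<gamma> z"
proof -
  obtain M where "M > 0" and M: "\<And>\<gamma>' n. norm \<gamma>' \<le> norm \<gamma> \<Longrightarrow> norm (heine_coeff \<alpha> \<beta> \<gamma>' n) \<le> M"
    using heine_coeff_bounded[of "norm \<gamma>" \<alpha> \<beta>] by auto
  from M[OF order_refl] show ?thesis
    unfolding heine_series_def using assms by (intro summable_sums bounded_coeff_summable(2))
qed

text \<open>This is the recursion \<open>heine_coeff_Suc\<close> for the coefficients, multiplied by \<open>z\<^sup>n\<close> and
summed: a factor \<open>q\<^sup>n\<close> in a coefficient corresponds to replacing \<open>z\<close> by \<open>zq\<close>.\<close>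

lemma heine_series_equation:
  assumes "norm z < 1"
  shows "(1 - z) * heine_series \<alpha> \<beta> \<gamma> z =
    (1 + \<gamma> / Q - z * (\<alpha> + \<beta>)) * heine_series \<alpha> \<beta> \<gamma> (z * Q)
    - (\<gamma> / Q - z * (\<alpha> * \<beta>)) * heine_series \<alpha> \<beta> \<gamma> (z * Q ^ 2)"
proof -
  let ?c = "heine_coeff \<alpha> \<beta> \<gamma>" and ?S = "heine_series \<alpha> \<beta> \<gamma>"
  define T where "T = (\<lambda>a b n. ?c n * z ^ n - a * (?c n * (z * Q) ^ n) + b * (?c n * (z * Q ^ 2) ^ n))"
  have sums: "T a b sums (?S z - a * ?S (z * Q) + b * ?S (z * Q ^ 2))" for a b
    unfolding T_def using assms norm_mult_Q_power_le[of z 1] norm_mult_Q_power_le[of z 2]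
    by (intro sums_add sums_diff sums_mult heine_series_sums) auto
  have T: "T a b n = ?c n * (1 - a * Q ^ n + b * (Q ^ n) ^ 2) * z ^ n" for a b n
    by (simp add: T_def algebra_simps power_mult_distrib power2_eq_square)
  have "T (1 + \<gamma> / Q) (\<gamma> / Q) 0 = 0" by (simp add: T)
  hence "(\<lambda>n. T (1 + \<gamma> / Q) (\<gamma> / Q) (Suc n)) sums
    (?S z - (1 + \<gamma> / Q) * ?S (z * Q) + \<gamma> / Q * ?S (z * Q ^ 2))"
    using sums[of "1 + \<gamma> / Q" "\<gamma> / Q"] by (simp add: sums_Suc_iff)
  also have "(\<lambda>n. T (1 + \<gamma> / Q) (\<gamma> / Q) (Suc n)) = (\<lambda>n. z * T (\<alpha> + \<beta>) (\<alpha> * \<beta>) n)"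
  proof
    fix n
    have "1 - (1 + \<gamma> / Q) * Q ^ Suc n + \<gamma> / Q * (Q ^ Suc n) ^ 2 = (1 - Q ^ Suc n) * (1 - \<gamma> * Q ^ n)"
      by (simp add: field_simps power2_eq_square)
    hence "T (1 + \<gamma> / Q) (\<gamma> / Q) (Suc n) =
      (?c (Suc n) * ((1 - Q ^ Suc n) * (1 - \<gamma> * Q ^ n))) * z ^ Suc n"
      unfolding T by simp
    also have "\<dots> = z * T (\<alpha> + \<beta>) (\<alpha> * \<beta>) n"
      unfolding heine_coeff_Suc T by (simp add: algebra_simps power2_eq_square)
    finally show "T (1 + \<gamma> / Q) (\<gamma> / Q) (Suc n) = z * T (\<alpha> + \<beta>) (\<alpha> * \<beta>) n" .
  qed
  finally have "?S z - (1 + \<gamma> / Q) * ?S (z * Q) + \<gamma> / Q * ?S (z * Q ^ 2) =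
    z * (?S z - (\<alpha> + \<beta>) * ?S (z * Q) + \<alpha> * \<beta> * ?S (z * Q ^ 2))"
    by (rule sums_unique2) (intro sums_mult sums)
  thus ?thesis by (simp add: algebra_simps)
qed

text \<open>The number of multiplications by \<open>q\<close> that bring \<open>z\<close> into the unit disc
serves as termination measure.\<close>

lemma continuation_depth_decreases:
  assumes "1 \<le> norm z" and "0 < k"
  shows "(LEAST n. norm (z * Q ^ k) * q ^ n < 1) < (LEAST n. norm z * q ^ n < 1)"
proof -
  obtain n where "norm z * q ^ n < 1"
    using small_q_power[OF zero_less_one] .
  define N where "N = (LEAST n. norm z * q ^ n < 1)"
  have N: "norm z * q ^ N < 1"
    unfolding N_def using \<open>norm z * q ^ n < 1\<close> by (rule LeastI)
  have "N \<noteq> 0" using N assms(1) by (intro notI) simp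
  then obtain N' where N': "N = Suc N'" by (cases N) auto
  have "q ^ k \<le> q ^ 1"
    using q_pos q_less_1 assms(2) by (intro power_decreasing) auto
  hence "norm z * q ^ N' * q ^ k \<le> norm z * q ^ N' * q"
    using q_pos by (intro mult_left_mono) auto
  hence "norm (z * Q ^ k) * q ^ N' < 1"
    using N unfolding N' by (simp add: norm_mult norm_power mult_ac)
  hence "(LEAST n. norm (z * Q ^ k) * q ^ n < 1) \<le> N'" by (rule Least_le)
  thus ?thesis unfolding N_def[symmetric] N' by simp
qed

text \<open>The continuation of \<open>(\<gamma>)\<^sub>\<infinity> \<^sub>2\<phi>\<^sub>1(\<alpha>,\<beta>;\<gamma>;q,z)\<close> in \<open>z\<close>: outside the unit disc the
\<open>q\<close>-difference equation is solved for the value at \<open>z\<close>.\<close>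

function heine_cont :: "complex \<Rightarrow> complex \<Rightarrow> complex \<Rightarrow> complex \<Rightarrow> complex" where
  "heine_cont \<alpha> \<beta> \<gamma> z =
    (if norm z < 1 then heine_series \<alpha> \<beta> \<gamma> z
     else ((1 + \<gamma> / Q - z * (\<alpha> + \<beta>)) * heine_cont \<alpha> \<beta> \<gamma> (z * Q)
           - (\<gamma> / Q - z * (\<alpha> * \<beta>)) * heine_cont \<alpha> \<beta> \<gamma> (z * Q ^ 2)) / (1 - z))"
  by auto
termination
proof (relation "Wellfounded.measure (\<lambda>(\<alpha>, \<beta>, \<gamma>, z). LEAST n. norm z * q ^ n < 1)", goal_cases)
  case (2 \<alpha> \<beta> \<gamma> z)
  thus ?case using continuation_depth_decreases[of z 1] by simp
next
  case (3 \<alpha> \<beta> \<gamma> z)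
  thus ?case using continuation_depth_decreases[of z 2] by simp
qed simp

declare heine_cont.simps [simp del]

lemma heine_cont_eq_series: "norm z < 1 \<Longrightarrow> heine_cont \<alpha> \<beta> \<gamma> z = heine_series \<alpha> \<beta> \<gamma> z"
  by (subst heine_cont.simps) simp

lemma heine_cont_0 [simp]: "heine_cont \<alpha> \<beta> \<gamma> 0 = poch_inf \<gamma>"
proof -
  have "heine_series \<alpha> \<beta> \<gamma> 0 = heine_coeff \<alpha> \<beta> \<gamma> 0"
    unfolding heine_series_def by (rule powser_zero)
  thus ?thesis by (simp add: heine_cont_eq_series heine_coeff_def)
qed

text \<open>At \<open>z = 1\<close> both sides are \<open>0\<close> because division by \<open>0\<close> yields \<open>0\<close>. Hence this is an identity
of functions on the whole plane and can be used for local properties such as analyticity.\<close>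

lemma heine_cont_step:
  "heine_cont \<alpha> \<beta> \<gamma> z =
    ((1 + \<gamma> / Q - z * (\<alpha> + \<beta>)) * heine_cont \<alpha> \<beta> \<gamma> (z * Q)
     - (\<gamma> / Q - z * (\<alpha> * \<beta>)) * heine_cont \<alpha> \<beta> \<gamma> (z * Q ^ 2)) / (1 - z)"
proof (cases "norm z < 1")
  case True
  hence "norm (z * Q) < 1" "norm (z * Q ^ 2) < 1" "z \<noteq> 1"
    using norm_mult_Q_power_le[of z 1] norm_mult_Q_power_le[of z 2] by auto
  thus ?thesis
    using True heine_series_equation[OF True, of \<alpha> \<beta> \<gamma>]
    by (simp add: heine_cont_eq_series eq_divide_eq mult.commute)
qed (subst heine_cont.simps, simp)

lemma heine_cont_step_fun:
  "heine_cont \<alpha> \<beta> \<gamma> = (\<lambda>z.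
    ((1 + \<gamma> / Q - z * (\<alpha> + \<beta>)) * heine_cont \<alpha> \<beta> \<gamma> (z * Q)
     - (\<gamma> / Q - z * (\<alpha> * \<beta>)) * heine_cont \<alpha> \<beta> \<gamma> (z * Q ^ 2)) / (1 - z))"
  by (rule ext, rule heine_cont_step)

lemma heine_cont_equation:
  assumes "z \<noteq> 1"
  shows "(1 - z) * heine_cont \<alpha> \<beta> \<gamma> z =
    (1 + \<gamma> / Q - z * (\<alpha> + \<beta>)) * heine_cont \<alpha> \<beta> \<gamma> (z * Q)
    - (\<gamma> / Q - z * (\<alpha> * \<beta>)) * heine_cont \<alpha> \<beta> \<gamma> (z * Q ^ 2)"
  using heine_cont_step[of \<alpha> \<beta> \<gamma> z] assms by (simp add: eq_divide_eq mult.commute)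

lemma heine_cont_holomorphic_ball: "heine_cont \<alpha> \<beta> \<gamma> holomorphic_on ball 0 1"
proof -
  have "heine_series \<alpha> \<beta> \<gamma> holomorphic_on ball 0 1"
    by (rule power_series_holomorphic[of _ _ "heine_coeff \<alpha> \<beta> \<gamma>"])
       (use heine_series_sums in auto)
  thus ?thesis
    by (rule holomorphic_transform) (auto simp: heine_cont_eq_series)
qed

lemma heine_cont_analytic_ball:
  assumes "norm z < 1" shows "heine_cont \<alpha> \<beta> \<gamma> analytic_on {z}"
proof (rule analytic_on_subset)
  show "heine_cont \<alpha> \<beta> \<gamma> analytic_on ball 0 1"
    using heine_cont_holomorphic_ball by (simp add: analytic_on_open)
qed (use assms in simp)

text \<open>The formula of \<open>heine_cont_step\<close> is analytic at \<open>z\<close> if the function is analytic at \<open>zq\<close>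
and \<open>zq\<^sup>2\<close> and \<open>z \<noteq> 1\<close>.\<close>

lemma heine_cont_analytic:
  assumes "z \<notin> poles"
  shows "heine_cont \<alpha> \<beta> \<gamma> analytic_on {z}"
proof (rule q_descent[of 1 "\<lambda>z. z \<notin> poles"])
  fix z assume z: "z \<notin> poles"
    and 1: "heine_cont \<alpha> \<beta> \<gamma> analytic_on {z * Q}" and 2: "heine_cont \<alpha> \<beta> \<gamma> analytic_on {z * Q ^ 2}"
  have "z \<noteq> 1" using z by auto
  have *: "(\<lambda>z. heine_cont \<alpha> \<beta> \<gamma> (z * Q)) analytic_on {z}"
    "(\<lambda>z. heine_cont \<alpha> \<beta> \<gamma> (z * Q ^ 2)) analytic_on {z}"
    using 1 2 by (auto intro: analytic_on_scaled)
  have "(\<lambda>z. ((1 + \<gamma> / Q - z * (\<alpha> + \<beta>)) * heine_cont \<alpha> \<beta> \<gamma> (z * Q)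
     - (\<gamma> / Q - z * (\<alpha> * \<beta>)) * heine_cont \<alpha> \<beta> \<gamma> (z * Q ^ 2)) / (1 - z)) analytic_on {z}"
    using * \<open>z \<noteq> 1\<close> by (intro analytic_intros) auto
  thus "heine_cont \<alpha> \<beta> \<gamma> analytic_on {z}"
    by (subst heine_cont_step_fun)
qed (use assms mult_Q_notin_poles heine_cont_analytic_ball in auto)

lemma heine_cont_meromorphic: "heine_cont \<alpha> \<beta> \<gamma> meromorphic_on UNIV"
proof -
  have "heine_cont \<alpha> \<beta> \<gamma> meromorphic_on {z}" for z
  proof (rule q_descent[of 1 "\<lambda>z. True"])
    fix z
    assume 1: "heine_cont \<alpha> \<beta> \<gamma> meromorphic_on {z * Q}"
      and 2: "heine_cont \<alpha> \<beta> \<gamma> meromorphic_on {z * Q ^ 2}"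
    have *: "(\<lambda>z. heine_cont \<alpha> \<beta> \<gamma> (z * Q)) meromorphic_on {z}"
      "(\<lambda>z. heine_cont \<alpha> \<beta> \<gamma> (z * Q ^ 2)) meromorphic_on {z}"
      by (rule meromorphic_on_compose[OF 1] meromorphic_on_compose[OF 2];
          auto intro!: analytic_on_mult analytic_on_ident analytic_on_const)+
    have "(\<lambda>z. ((1 + \<gamma> / Q - z * (\<alpha> + \<beta>)) * heine_cont \<alpha> \<beta> \<gamma> (z * Q)
       - (\<gamma> / Q - z * (\<alpha> * \<beta>)) * heine_cont \<alpha> \<beta> \<gamma> (z * Q ^ 2)) / (1 - z)) meromorphic_on {z}"
      using * by (intro meromorphic_intros) (auto intro!: meromorphic_intros)
    thus "heine_cont \<alpha> \<beta> \<gamma> meromorphic_on {z}"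
      by (subst heine_cont_step_fun)
  qed (auto intro!: analytic_on_imp_meromorphic_on heine_cont_analytic_ball)
  thus ?thesis unfolding meromorphic_on_def by blast
qed

lemma closed_poles: "closed poles"
proof -
  have "closed {x. poch_inf x = 0}"
    by (intro closed_Collect_eq continuous_poch_inf continuous_on_const)
  thus ?thesis by (simp add: poch_inf_eq_0_iff)
qed

lemma open_Compl_poles: "open (- poles)"
  using closed_poles by (rule open_Compl)

lemma connected_Compl_poles: "connected (- poles)"
  unfolding q_neg_powers_def
  by (intro path_connected_imp_connected path_connected_complement_countable) auto

lemma heine_cont_holomorphic: "heine_cont \<alpha> \<beta> \<gamma> holomorphic_on (- poles)"
  by (rule analytic_imp_holomorphic, subst analytic_on_analytic_at) (simp add: heine_cont_analytic)

lemma heine_cont_isCont: "z \<notin> poles \<Longrightarrow> isCont (heine_cont \<alpha> \<beta> \<gamma>) z"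
  using heine_cont_analytic[of z \<alpha> \<beta> \<gamma>] by (rule analytic_at_imp_isCont)

lemma phi21_series_eq:
  assumes "\<gamma> \<notin> poles" and "norm z < 1"
  shows "phi21_series q \<alpha> \<beta> \<gamma> z = heine_cont \<alpha> \<beta> \<gamma> z / poch_inf \<gamma>"
proof -
  have nz: "poch_inf \<gamma> \<noteq> 0" using assms poch_inf_eq_0_iff by blast
  have "(\<lambda>n. heine_coeff \<alpha> \<beta> \<gamma> n * z ^ n / poch_inf \<gamma>) sums (heine_series \<alpha> \<beta> \<gamma> z / poch_inf \<gamma>)"
    by (intro sums_divide heine_series_sums assms)
  moreover have "heine_coeff \<alpha> \<beta> \<gamma> n * z ^ n / poch_inf \<gamma> =
    poch \<alpha> n * poch \<beta> n / (poch Q n * poch \<gamma> n) * z ^ n" for n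
    using nz poch_nonzero[OF assms(1), of n] poch_inf_split[of \<gamma> n]
    by (simp add: heine_coeff_def field_simps)
  ultimately show ?thesis
    unfolding phi21_series_def using assms(2) by (simp add: sums_iff heine_cont_eq_series)
qed

text \<open>The complement of the countable set of poles is connected, so a holomorphic function on it
is determined by its values in the unit disc. Hence the function chosen in the definition of \<open>phi21\<close> is the
continuation constructed here.\<close>

lemma phi21_eq_heine_cont:
  assumes "\<gamma> \<notin> poles" and "z \<notin> poles"
  shows "phi21 q \<alpha> \<beta> \<gamma> z = heine_cont \<alpha> \<beta> \<gamma> z / poch_inf \<gamma>"
proof -
  let ?P = "\<lambda>F. F meromorphic_on UNIV \<and> F holomorphic_on (- poles) \<and>
       (\<forall>z. norm z < 1 \<longrightarrow> F z = phi21_series q \<alpha> \<beta> \<gamma> z)"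
  have nz: "poch_inf \<gamma> \<noteq> 0" using assms poch_inf_eq_0_iff by blast
  have "?P (\<lambda>z. heine_cont \<alpha> \<beta> \<gamma> z / poch_inf \<gamma>)"
  proof (intro conjI allI impI)
    show "(\<lambda>z. heine_cont \<alpha> \<beta> \<gamma> z / poch_inf \<gamma>) meromorphic_on UNIV"
      by (intro meromorphic_on_divide heine_cont_meromorphic meromorphic_on_const)
    show "(\<lambda>z. heine_cont \<alpha> \<beta> \<gamma> z / poch_inf \<gamma>) holomorphic_on (- poles)"
      using nz by (intro holomorphic_intros heine_cont_holomorphic) auto
  qed (rule phi21_series_eq[OF assms(1), symmetric])
  hence P: "?P (phi21 q \<alpha> \<beta> \<gamma>)"
    unfolding phi21_def by (rule someI[of ?P])
  show ?thesis
  proof (rule analytic_continuation_open[of "ball 0 1" "- poles" "phi21 q \<alpha> \<beta> \<gamma>"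
        "\<lambda>z. heine_cont \<alpha> \<beta> \<gamma> z / poch_inf \<gamma>"])
    show "(\<lambda>z. heine_cont \<alpha> \<beta> \<gamma> z / poch_inf \<gamma>) holomorphic_on (- poles)"
      using nz by (intro holomorphic_intros heine_cont_holomorphic) auto
    show "phi21 q \<alpha> \<beta> \<gamma> holomorphic_on (- poles)" using P by blast
    show "phi21 q \<alpha> \<beta> \<gamma> w = heine_cont \<alpha> \<beta> \<gamma> w / poch_inf \<gamma>" if "w \<in> ball 0 1" for w
    proof -
      have "norm w < 1" using that by simp
      hence "phi21 q \<alpha> \<beta> \<gamma> w = phi21_series q \<alpha> \<beta> \<gamma> w" using P by blast
      also have "\<dots> = heine_cont \<alpha> \<beta> \<gamma> w / poch_inf \<gamma>"
        using assms(1) \<open>norm w < 1\<close> by (rule phi21_series_eq)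
      finally show ?thesis .
    qed
    show "ball 0 1 \<subseteq> - poles" using norm_less_1_notin_poles by auto
    show "z \<in> - poles" using assms by simp
  qed (use connected_Compl_poles open_Compl_poles in simp_all)
qed

text \<open>In the unit disc the series converges uniformly in \<open>\<gamma>\<close> and \<open>z\<close>;
elsewhere the continuity is inherited through the \<open>q\<close>-difference equation. Joint continuity is needed because
both \<open>\<gamma> = ab\<close> and \<open>z = -bx/a\<close> move when \<open>b\<close> does.\<close>

lemma heine_cont_jointly_continuous:
  assumes "z \<notin> poles"
  shows "isCont (\<lambda>p. heine_cont \<alpha> \<beta> (fst p) (snd p)) (\<gamma>, z)"
proof (rule q_descent[where r = 1 and R = "\<lambda>z. z \<notin> poles"
      and P = "\<lambda>z. isCont (\<lambda>p. heine_cont \<alpha> \<beta> (fst p) (snd p)) (\<gamma>, z)"])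
  fix z :: complex assume "z \<notin> poles" and z: "norm z < 1"
  \<comment> \<open>a radius strictly between \<open>|z|\<close> and \<open>1\<close>, for a geometric majorant near \<open>z\<close>\<close>
  define r where "r = (norm z + 1) / 2"
  define X where "X = ball (0 :: complex) (norm \<gamma> + 1) \<times> ball (0 :: complex) r"
  have r: "norm z < r" "r < 1" using z by (auto simp: r_def)
  obtain M where M: "M > 0" "\<And>g n. norm g \<le> norm \<gamma> + 1 \<Longrightarrow> norm (heine_coeff \<alpha> \<beta> g n) \<le> M"
    using heine_coeff_bounded[of "norm \<gamma> + 1" \<alpha> \<beta>] by auto
  have lim: "uniform_limit X (\<lambda>n p. \<Sum>i<n. heine_coeff \<alpha> \<beta> (fst p) i * snd p ^ i)
    (\<lambda>p. \<Sum>i. heine_coeff \<alpha> \<beta> (fst p) i * snd p ^ i) sequentially"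
  proof (rule Weierstrass_m_test)
    show "norm (heine_coeff \<alpha> \<beta> (fst p) n * snd p ^ n) \<le> M * r ^ n" if "p \<in> X" for n p
    proof -
      have "norm (fst p) \<le> norm \<gamma> + 1" "norm (snd p) \<le> r" using that by (auto simp: X_def)
      thus ?thesis using M by (auto simp: norm_mult norm_power intro!: mult_mono power_mono)
    qed
    have "0 \<le> r" using r norm_ge_zero[of z] by linarith
    hence "norm r < 1" using r by simp
    thus "summable (\<lambda>n. M * r ^ n)" by (intro summable_mult summable_geometric)
  qed
  have "continuous_on X (\<lambda>p. \<Sum>i. heine_coeff \<alpha> \<beta> (fst p) i * snd p ^ i)"
  proof (rule uniform_limit_theorem[OF _ lim])
    have "continuous_on X (\<lambda>p. poch_inf (fst p * Q ^ i))" for i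
      by (rule continuous_on_compose2[OF continuous_poch_inf]) (auto intro!: continuous_intros)
    thus "\<forall>\<^sub>F n in sequentially. continuous_on X (\<lambda>p. \<Sum>i<n. heine_coeff \<alpha> \<beta> (fst p) i * snd p ^ i)"
      unfolding heine_coeff_def by (intro always_eventually allI continuous_intros) auto
  qed simp
  also have "continuous_on X (\<lambda>p. \<Sum>i. heine_coeff \<alpha> \<beta> (fst p) i * snd p ^ i) \<longleftrightarrow>
    continuous_on X (\<lambda>p. heine_cont \<alpha> \<beta> (fst p) (snd p))"
    using r by (intro continuous_on_cong) (auto simp: heine_cont_eq_series heine_series_def X_def)
  finally have "continuous_on X (\<lambda>p. heine_cont \<alpha> \<beta> (fst p) (snd p))" .
  moreover have "open X" "(\<gamma>, z) \<in> X" using r by (auto simp: X_def open_Times)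
  ultimately show "isCont (\<lambda>p. heine_cont \<alpha> \<beta> (fst p) (snd p)) (\<gamma>, z)"
    using continuous_on_eq_continuous_at by blast
next
  fix z assume z: "z \<notin> poles"
    and 1: "isCont (\<lambda>p. heine_cont \<alpha> \<beta> (fst p) (snd p)) (\<gamma>, z * Q)"
    and 2: "isCont (\<lambda>p. heine_cont \<alpha> \<beta> (fst p) (snd p)) (\<gamma>, z * Q ^ 2)"
  have "z \<noteq> 1" using z by auto
  have "isCont (\<lambda>p. heine_cont \<alpha> \<beta> (fst p) (snd p * Q)) (\<gamma>, z)"
    using isCont_o2[of "(\<gamma>, z)" "\<lambda>p. (fst p, snd p * Q)" "\<lambda>p. heine_cont \<alpha> \<beta> (fst p) (snd p)"] 1
    by (auto intro!: continuous_intros)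
  moreover have "isCont (\<lambda>p. heine_cont \<alpha> \<beta> (fst p) (snd p * Q ^ 2)) (\<gamma>, z)"
    using isCont_o2[of "(\<gamma>, z)" "\<lambda>p. (fst p, snd p * Q ^ 2)" "\<lambda>p. heine_cont \<alpha> \<beta> (fst p) (snd p)"] 2
    by (auto intro!: continuous_intros)
  ultimately have "isCont (\<lambda>p.
    ((1 + fst p / Q - snd p * (\<alpha> + \<beta>)) * heine_cont \<alpha> \<beta> (fst p) (snd p * Q)
     - (fst p / Q - snd p * (\<alpha> * \<beta>)) * heine_cont \<alpha> \<beta> (fst p) (snd p * Q ^ 2)) / (1 - snd p)) (\<gamma>, z)"
    using \<open>z \<noteq> 1\<close> by (intro continuous_intros) auto
  thus "isCont (\<lambda>p. heine_cont \<alpha> \<beta> (fst p) (snd p)) (\<gamma>, z)"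
    by (simp only: heine_cont_step[symmetric])
qed (use assms mult_Q_notin_poles in auto)

section \<open>Multiplying the lower parameter\<close>

lemma heine_cont_orbit_tendsto:
  "(\<lambda>j. heine_cont \<alpha> \<beta> \<gamma> (z * Q ^ j)) \<longlonglongrightarrow> poch_inf \<gamma>"
proof -
  have "(\<lambda>j. z * Q ^ j) \<longlonglongrightarrow> 0"
    using tendsto_mult[OF tendsto_const Q_powers_tendsto_0] by simp
  from isCont_tendsto_compose[OF heine_cont_isCont[OF zero_notin_poles] this]
  show ?thesis by simp
qed

lemma heine_cont_orbit_bounded:
  "\<exists>M>0. \<forall>j. norm (heine_cont \<alpha> \<beta> \<gamma> (z * Q ^ j)) \<le> M"
  using convergent_imp_Bseq[OF convergentI[OF heine_cont_orbit_tendsto[of \<alpha> \<beta> \<gamma> z]]]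
  unfolding Bseq_def .

text \<open>Exchange the order of summation in the double series. The inner sum
\<open>\<Sum>j. (t)\<^sub>j/(q)\<^sub>j (\<gamma>q\<^sup>n)\<^sup>j = (\<gamma>tq\<^sup>n)\<^sub>\<infinity>/(\<gamma>q\<^sup>n)\<^sub>\<infinity>\<close> replaces the factor \<open>(\<gamma>q\<^sup>n)\<^sub>\<infinity>\<close> of the
\<open>n\<close>-th coefficient by \<open>(\<gamma>tq\<^sup>n)\<^sub>\<infinity>\<close>.\<close>

lemma heine_cont_binomial_sum_disc:
  assumes \<gamma>: "norm \<gamma> < 1" and z: "norm z < 1"
  shows "(\<lambda>j. binom_coeff t j * \<gamma> ^ j * heine_cont \<alpha> \<beta> \<gamma> (z * Q ^ j)) sums
    heine_cont \<alpha> \<beta> (\<gamma> * t) z"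
proof -
  obtain M where M: "M > 0" "\<And>j. norm (binom_coeff t j) \<le> M" using binom_coeff_bounded by blast
  obtain M' where M': "M' > 0" "\<And>n. norm (heine_coeff \<alpha> \<beta> \<gamma> n) \<le> M'"
    using heine_coeff_bounded[of "norm \<gamma>" \<alpha> \<beta>] by auto
  define a where "a = (\<lambda>j n. binom_coeff t j * \<gamma> ^ j * (heine_coeff \<alpha> \<beta> \<gamma> n * (z * Q ^ j) ^ n))"
  have bound: "norm (a j n) \<le> (M * norm \<gamma> ^ j) * (M' * norm z ^ n)" for j n
  proof -
    have "norm (z * Q ^ j) ^ n \<le> norm z ^ n"
      using norm_mult_Q_power_le[of z j] by (intro power_mono) auto
    hence "norm (binom_coeff t j) * norm \<gamma> ^ j * (norm (heine_coeff \<alpha> \<beta> \<gamma> n) * norm (z * Q ^ j) ^ n)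
      \<le> (M * norm \<gamma> ^ j) * (M' * norm z ^ n)"
      using M M' by (intro mult_mono) auto
    thus ?thesis by (simp only: a_def norm_mult norm_power)
  qed
  have A: "summable (\<lambda>j. M * norm \<gamma> ^ j)" "\<And>j. 0 \<le> M * norm \<gamma> ^ j"
    and B: "summable (\<lambda>n. M' * norm z ^ n)" "\<And>n. 0 \<le> M' * norm z ^ n"
    using \<gamma> z M(1) M'(1) by (auto intro!: summable_mult summable_geometric)
  note swap = double_series_rearrangement[OF bound A B]
  have rows: "(\<Sum>n. a j n) = binom_coeff t j * \<gamma> ^ j * heine_cont \<alpha> \<beta> \<gamma> (z * Q ^ j)" for j
  proof -
    have "norm (z * Q ^ j) < 1" using norm_mult_Q_power_le[of z j] z by simp
    thus ?thesis
      using sums_unique[OF sums_mult[OF heine_series_sums]]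
      unfolding a_def by (simp add: heine_cont_eq_series)
  qed
  have cols: "(\<Sum>j. a j n) = heine_coeff \<alpha> \<beta> (\<gamma> * t) n * z ^ n" for n
  proof -
    have small: "norm (\<gamma> * Q ^ n) < 1" using norm_mult_Q_power_le[of \<gamma> n] \<gamma> by simp
    hence nz: "poch_inf (\<gamma> * Q ^ n) \<noteq> 0"
      using norm_less_1_notin_poles poch_inf_eq_0_iff by blast
    have "(\<lambda>j. heine_coeff \<alpha> \<beta> \<gamma> n * z ^ n * (binom_coeff t j * (\<gamma> * Q ^ n) ^ j)) sums
      (heine_coeff \<alpha> \<beta> \<gamma> n * z ^ n * (poch_inf (t * (\<gamma> * Q ^ n)) / poch_inf (\<gamma> * Q ^ n)))"
      by (intro sums_mult q_binomial small)
    also have "(\<lambda>j. heine_coeff \<alpha> \<beta> \<gamma> n * z ^ n * (binom_coeff t j * (\<gamma> * Q ^ n) ^ j)) = (\<lambda>j. a j n)"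
      by (simp add: a_def power_mult_distrib power_mult[symmetric] mult_ac)
    also have "heine_coeff \<alpha> \<beta> \<gamma> n * z ^ n * (poch_inf (t * (\<gamma> * Q ^ n)) / poch_inf (\<gamma> * Q ^ n)) =
      heine_coeff \<alpha> \<beta> (\<gamma> * t) n * z ^ n"
      using nz by (simp add: heine_coeff_def mult_ac)
    finally show ?thesis by (simp add: sums_iff)
  qed
  have "(\<Sum>j. \<Sum>n. a j n) = heine_cont \<alpha> \<beta> (\<gamma> * t) z"
    using swap(1) heine_series_sums[OF z, of \<alpha> \<beta> "\<gamma> * t"] z
    unfolding cols by (simp add: sums_iff heine_cont_eq_series)
  thus ?thesis using swap(4) unfolding rows by (simp add: sums_iff)
qed

text \<open>The sum on the left satisfies the \<open>q\<close>-difference equation with lower parameter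
\<open>\<gamma>t\<close>, so the identity extends from the unit disc. To see this, add up the equations with lower parameter
\<open>\<gamma>\<close> at the points \<open>zq\<^sup>j\<close>. The two equations differ by a telescoping series.\<close>

theorem heine_cont_binomial_sum:
  assumes \<gamma>: "norm \<gamma> < 1" and "z \<notin> poles"
  shows "(\<lambda>j. binom_coeff t j * \<gamma> ^ j * heine_cont \<alpha> \<beta> \<gamma> (z * Q ^ j)) sums
    heine_cont \<alpha> \<beta> (\<gamma> * t) z"
proof (rule q_descent[where r = 1 and R = "\<lambda>z. z \<notin> poles" and z = z])
  fix z assume z: "z \<notin> poles"
    and IH1: "(\<lambda>j. binom_coeff t j * \<gamma> ^ j * heine_cont \<alpha> \<beta> \<gamma> (z * Q * Q ^ j)) sums
      heine_cont \<alpha> \<beta> (\<gamma> * t) (z * Q)"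
    and IH2: "(\<lambda>j. binom_coeff t j * \<gamma> ^ j * heine_cont \<alpha> \<beta> \<gamma> (z * Q ^ 2 * Q ^ j)) sums
      heine_cont \<alpha> \<beta> (\<gamma> * t) (z * Q ^ 2)"
  show "(\<lambda>j. binom_coeff t j * \<gamma> ^ j * heine_cont \<alpha> \<beta> \<gamma> (z * Q ^ j)) sums
    heine_cont \<alpha> \<beta> (\<gamma> * t) z"
  proof (cases "z = 0")
    case True
    thus ?thesis using heine_cont_binomial_sum_disc[OF \<gamma>, of 0] by simp
  next
    case False
    have "z \<noteq> 1" using z by auto
    define u where "u = (\<lambda>j. heine_cont \<alpha> \<beta> \<gamma> (z * Q ^ j))"
    define e where "e = (\<lambda>j. binom_coeff t j * \<gamma> ^ j)"
    (* The equation at z * Q ^ j carries z * Q ^ j where the equation at z carries z.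
       Dividing it by Q ^ j removes the discrepancy and is the source of the quotients by Q ^ j. *)
    define s where "s = (\<lambda>j. e j * (1 - 1 / Q ^ j))"
    define r where "r = (\<lambda>j. e j * ((1 + \<gamma> / Q) / Q ^ j - (1 + \<gamma> * t / Q)))"
    define p where "p = (\<lambda>j. e j * (\<gamma> * t / Q - \<gamma> / Q / Q ^ j))"
    have e_Suc: "e (Suc j) * (1 - Q ^ Suc j) = e j * (\<gamma> * (1 - t * Q ^ j))" for j
      unfolding e_def by (rule binom_coeff_power_Suc)
    have p_eq: "p j = s (Suc j)" for j
    proof -
      have "s (Suc j) = - (e (Suc j) * (1 - Q ^ Suc j)) / Q ^ Suc j"
        by (simp add: s_def field_simps)
      also have "\<dots> = p j"
        unfolding e_Suc by (simp add: p_def field_simps)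
      finally show ?thesis ..
    qed
    have psr: "p j + r j + s j = 0" for j
      by (simp add: p_def r_def s_def algebra_simps add_divide_distrib)
    have tel: "(\<lambda>j. p j * u (j + 2) + r j * u (j + 1) + s j * u j) sums 0"
    proof (rule three_term_telescope_sums)
      show "s 0 = 0" by (simp add: s_def)
      thus "r 0 + s 1 = 0" using psr[of 0] p_eq[of 0] by (simp add: add.commute)
      show "p n + r (Suc n) + s (n + 2) = 0" for n
        using psr[of "Suc n"] p_eq[of n] p_eq[of "Suc n"] by (simp add: add_ac)
      (* The boundary term is e (n + 1) (1 - 1 / Q ^ (n + 1)) (u (n + 2) - u (n + 1)). The factor 1 / Q ^ (n + 1)
         is compensated by the difference of the values of u, by differentiability at 0, and e n tends to 0. *)
      define D where "D = deriv (heine_cont \<alpha> \<beta> \<gamma>) 0"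
      have "(heine_cont \<alpha> \<beta> \<gamma> has_field_derivative D) (at 0)"
        unfolding D_def using heine_cont_analytic[OF zero_notin_poles]
        by (intro DERIV_deriv_iff_field_differentiable[THEN iffD2] analytic_on_imp_differentiable_at) auto
      hence "((\<lambda>h. (heine_cont \<alpha> \<beta> \<gamma> h - heine_cont \<alpha> \<beta> \<gamma> 0) / h) \<longlongrightarrow> D) (at 0)"
        by (simp add: DERIV_def)
      moreover have "filterlim (\<lambda>n. z * Q ^ n) (at 0) sequentially"
        unfolding filterlim_at using False tendsto_mult[OF tendsto_const Q_powers_tendsto_0, of z] by simp
      ultimately have quot: "(\<lambda>n. (u n - heine_cont \<alpha> \<beta> \<gamma> 0) / (z * Q ^ n)) \<longlonglongrightarrow> D"
        unfolding u_def by (rule filterlim_compose)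
      have "(\<lambda>n. e n) \<longlonglongrightarrow> 0"
      proof -
        obtain M where M: "\<And>n. norm (binom_coeff t n) \<le> M" using binom_coeff_bounded by blast
        show ?thesis unfolding e_def
          by (rule summable_LIMSEQ_zero, rule bounded_coeff_summable(2)) (use M \<gamma> in auto)
      qed
      hence "(\<lambda>n. e (Suc n) * (Q ^ Suc n - 1) * (z * Q * ((u (Suc (Suc n)) - heine_cont \<alpha> \<beta> \<gamma> 0) / (z * Q ^ Suc (Suc n))) -
           z * ((u (Suc n) - heine_cont \<alpha> \<beta> \<gamma> 0) / (z * Q ^ Suc n)))) \<longlonglongrightarrow> 0 * (0 - 1) * (z * Q * D - z * D)"
        by (intro tendsto_intros LIMSEQ_Suc[OF LIMSEQ_Suc[OF quot]] LIMSEQ_Suc[OF quot]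
            LIMSEQ_Suc[OF Q_powers_tendsto_0] LIMSEQ_Suc)
      moreover have "e (Suc n) * (Q ^ Suc n - 1) * (z * Q * ((u (Suc (Suc n)) - heine_cont \<alpha> \<beta> \<gamma> 0) / (z * Q ^ Suc (Suc n))) -
           z * ((u (Suc n) - heine_cont \<alpha> \<beta> \<gamma> 0) / (z * Q ^ Suc n))) =
           p n * u (n + 2) - s (n + 1) * u (n + 1)" for n
      proof -
        have "z * Q * ((u (Suc (Suc n)) - heine_cont \<alpha> \<beta> \<gamma> 0) / (z * Q ^ Suc (Suc n))) -
           z * ((u (Suc n) - heine_cont \<alpha> \<beta> \<gamma> 0) / (z * Q ^ Suc n)) =
           (u (Suc (Suc n)) - u (Suc n)) / Q ^ Suc n"
          using False by (simp add: field_simps)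
        moreover have "e (Suc n) * (Q ^ Suc n - 1) * ((u (Suc (Suc n)) - u (Suc n)) / Q ^ Suc n) =
           s (Suc n) * (u (Suc (Suc n)) - u (Suc n))"
          by (simp add: s_def field_simps)
        ultimately show ?thesis unfolding p_eq by (simp add: algebra_simps)
      qed
      ultimately show "(\<lambda>n. p n * u (n + 2) - s (n + 1) * u (n + 1)) \<longlonglongrightarrow> 0" by simp
    qed
    have rec: "(1 - z * Q ^ j) * u j =
      (1 + \<gamma> / Q - z * Q ^ j * (\<alpha> + \<beta>)) * u (j + 1) - (\<gamma> / Q - z * Q ^ j * (\<alpha> * \<beta>)) * u (j + 2)" for j
    proof -
      have "z * Q ^ j \<noteq> 1" using mult_Q_power_notin_poles[OF z, of j] by auto
      from heine_cont_equation[OF this, of \<alpha> \<beta> \<gamma>] show ?thesis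
        by (simp add: u_def mult_ac power2_eq_square)
    qed
    have termwise: "(p j * u (j + 2) + r j * u (j + 1) + s j * u j) +
        (1 + \<gamma> * t / Q - z * (\<alpha> + \<beta>)) * (e j * u (j + 1)) -
        (\<gamma> * t / Q - z * (\<alpha> * \<beta>)) * (e j * u (j + 2)) = (1 - z) * (e j * u j)" for j
    proof -
      have "u j = z * Q ^ j * u j + (1 + \<gamma> / Q - z * Q ^ j * (\<alpha> + \<beta>)) * u (j + 1)
          - (\<gamma> / Q - z * Q ^ j * (\<alpha> * \<beta>)) * u (j + 2)"
        using rec[of j] by (simp add: algebra_simps)
      hence "u j / Q ^ j = (z * Q ^ j * u j + (1 + \<gamma> / Q - z * Q ^ j * (\<alpha> + \<beta>)) * u (j + 1)
          - (\<gamma> / Q - z * Q ^ j * (\<alpha> * \<beta>)) * u (j + 2)) / Q ^ j"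
        by (rule arg_cong)
      also have "\<dots> = z * u j + ((1 + \<gamma> / Q) / Q ^ j - z * (\<alpha> + \<beta>)) * u (j + 1)
          - (\<gamma> / Q / Q ^ j - z * (\<alpha> * \<beta>)) * u (j + 2)"
        by (simp add: field_simps)
      finally have "e j * (u j / Q ^ j) = e j * (z * u j + ((1 + \<gamma> / Q) / Q ^ j - z * (\<alpha> + \<beta>)) * u (j + 1)
          - (\<gamma> / Q / Q ^ j - z * (\<alpha> * \<beta>)) * u (j + 2))" by simp
      thus ?thesis by (simp add: p_def r_def s_def algebra_simps)
    qed
    have "(\<lambda>j. e j * u (j + 1)) sums heine_cont \<alpha> \<beta> (\<gamma> * t) (z * Q)"
      using IH1 by (simp add: e_def u_def mult_ac)
    moreover have "(\<lambda>j. e j * u (j + 2)) sums heine_cont \<alpha> \<beta> (\<gamma> * t) (z * Q ^ 2)"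
      using IH2 by (simp add: e_def u_def mult_ac power2_eq_square)
    ultimately have "(\<lambda>j. (1 - z) * (e j * u j)) sums
      (0 + (1 + \<gamma> * t / Q - z * (\<alpha> + \<beta>)) * heine_cont \<alpha> \<beta> (\<gamma> * t) (z * Q) -
        (\<gamma> * t / Q - z * (\<alpha> * \<beta>)) * heine_cont \<alpha> \<beta> (\<gamma> * t) (z * Q ^ 2))"
      unfolding termwise[symmetric] by (intro sums_add sums_diff sums_mult tel)
    hence "(\<lambda>j. (1 - z) * (e j * u j)) sums ((1 - z) * heine_cont \<alpha> \<beta> (\<gamma> * t) z)"
      by (simp only: add_0 heine_cont_equation[OF \<open>z \<noteq> 1\<close>])
    hence "(\<lambda>j. e j * u j) sums heine_cont \<alpha> \<beta> (\<gamma> * t) z"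
      using \<open>z \<noteq> 1\<close> by (subst (asm) sums_mult_iff) auto
    thus ?thesis by (simp add: e_def u_def)
  qed
qed (use assms heine_cont_binomial_sum_disc[OF \<gamma>] mult_Q_notin_poles in auto)

section \<open>Euler's transformation\<close>

text \<open>A nonzero solution would be \<open>z\<^sup>n g(z)\<close> with \<open>n > 0\<close> and \<open>g(0) \<noteq> 0\<close>. Comparing
the lowest-order terms of the equation gives \<open>1 - A(0) q\<^sup>n + B(0) q\<^sup>2\<^sup>n = 0\<close>.\<close>

lemma analytic_solution_vanishes:
  fixes d A B :: "complex \<Rightarrow> complex"
  assumes hol: "d holomorphic_on ball 0 r" and "r > 0" and d0: "d 0 = 0"
    and cont: "isCont A 0" "isCont B 0"
    and eq: "\<And>z. norm z < r \<Longrightarrow> d z = A z * d (z * Q) - B z * d (z * Q ^ 2)"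
    and indicial: "\<And>n. n > 0 \<Longrightarrow> 1 - A 0 * Q ^ n + B 0 * (Q ^ n) ^ 2 \<noteq> 0"
  shows "\<And>z. norm z < r \<Longrightarrow> d z = 0"
proof (rule ccontr)
  fix z assume z: "norm z < r" "d z \<noteq> 0"
  have nonconst: "\<not> d constant_on ball 0 r"
  proof
    assume "d constant_on ball 0 r"
    then obtain c where "\<And>x. x \<in> ball 0 r \<Longrightarrow> d x = c" unfolding constant_on_def by blast
    hence "d z = d 0" using z \<open>r > 0\<close> by simp
    thus False using z d0 by simp
  qed
  have "0 \<in> ball (0 :: complex) r" using \<open>r > 0\<close> by simp
  hence "\<exists>g \<rho> n. 0 < n \<and> 0 < \<rho> \<and> ball (0 :: complex) \<rho> \<subseteq> ball 0 r \<and> g holomorphic_on ball 0 \<rho> \<and>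
    (\<forall>w\<in>ball 0 \<rho>. d w = (w - 0) ^ n * g w \<and> g w \<noteq> 0)"
  proof (rule holomorphic_factor_zero_nonconstant[OF hol open_ball connected_ball _ d0 nonconst], goal_cases)
    case (1 g \<rho> n)
    thus ?case by (intro exI[of _ g] exI[of _ \<rho>] exI[of _ n]) simp
  qed
  then obtain g \<rho> n where n: "0 < n" and \<rho>: "0 < \<rho>" "ball (0 :: complex) \<rho> \<subseteq> ball 0 r"
    and g: "g holomorphic_on ball 0 \<rho>" "\<And>w. w \<in> ball 0 \<rho> \<Longrightarrow> d w = (w - 0) ^ n * g w"
      "\<And>w. w \<in> ball 0 \<rho> \<Longrightarrow> g w \<noteq> 0" by blast
  have g0: "isCont g 0"
    using g(1) \<rho>(1) by (intro continuous_on_interior[of "ball 0 \<rho>"] holomorphic_on_imp_continuous_on) auto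
  have g_eq: "g w = A w * Q ^ n * g (w * Q) - B w * (Q ^ n) ^ 2 * g (w * Q ^ 2)"
    if w: "w \<in> ball 0 \<rho>" "w \<noteq> 0" for w
  proof -
    have in_ball: "w * Q \<in> ball 0 \<rho>" "w * Q ^ 2 \<in> ball 0 \<rho>"
      using w norm_mult_Q_power_le[of w 1] norm_mult_Q_power_le[of w 2] by auto
    have "norm w < r" using w \<rho> by auto
    from eq[OF this] have "w ^ n * g w = A w * ((w * Q) ^ n * g (w * Q)) - B w * ((w * Q ^ 2) ^ n * g (w * Q ^ 2))"
      using g(2) w in_ball by simp
    also have "\<dots> = w ^ n * (A w * Q ^ n * g (w * Q) - B w * (Q ^ n) ^ 2 * g (w * Q ^ 2))"
      by (simp add: algebra_simps power_mult_distrib power_mult[symmetric])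
    finally show ?thesis using w(2) by simp
  qed
  have "((\<lambda>w. A w * Q ^ n * g (w * Q) - B w * (Q ^ n) ^ 2 * g (w * Q ^ 2)) \<longlongrightarrow>
    A 0 * Q ^ n * g (0 * Q) - B 0 * (Q ^ n) ^ 2 * g (0 * Q ^ 2)) (at 0)"
  proof -
    have "isCont (\<lambda>w. g (w * Q)) 0" "isCont (\<lambda>w. g (w * Q ^ 2)) 0"
      using isCont_o2[of 0 "\<lambda>w. w * Q" g] isCont_o2[of 0 "\<lambda>w. w * Q ^ 2" g] g0 by auto
    hence "isCont (\<lambda>w. A w * Q ^ n * g (w * Q) - B w * (Q ^ n) ^ 2 * g (w * Q ^ 2)) 0"
      using cont by (intro continuous_intros)
    thus ?thesis by (simp only: isCont_def)
  qed
  moreover have "eventually (\<lambda>w. w \<in> ball 0 \<rho> - {0}) (at 0)"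
    using \<rho>(1) by (intro eventually_at_in_open) auto
  hence "eventually (\<lambda>w. g w = A w * Q ^ n * g (w * Q) - B w * (Q ^ n) ^ 2 * g (w * Q ^ 2)) (at 0)"
    by eventually_elim (use g_eq in auto)
  ultimately have "(g \<longlongrightarrow> A 0 * Q ^ n * g (0 * Q) - B 0 * (Q ^ n) ^ 2 * g (0 * Q ^ 2)) (at 0)"
    by (subst tendsto_cong)
  moreover have "(g \<longlongrightarrow> g 0) (at 0)" using g0 by (simp add: isCont_def)
  ultimately have "g 0 = A 0 * Q ^ n * g 0 - B 0 * (Q ^ n) ^ 2 * g 0"
    using LIM_unique by fastforce
  hence "g 0 * (1 - A 0 * Q ^ n + B 0 * (Q ^ n) ^ 2) = 0" by (simp add: algebra_simps)
  thus False using indicial[OF n] g(3)[of 0] \<rho>(1) by simp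
qed

text \<open>Multiplication by \<open>(z)\<^sub>\<infinity>\<close> removes the poles and the division by \<open>1 - z\<close>. In this form
the equation shows the symmetry that is behind Euler's transformation.\<close>

lemma entire_heine_equation:
  assumes "z \<notin> poles"
  shows "poch_inf z * heine_cont \<alpha> \<beta> \<gamma> z =
    (1 + \<gamma> / Q - z * (\<alpha> + \<beta>)) * (poch_inf (z * Q) * heine_cont \<alpha> \<beta> \<gamma> (z * Q))
    - (\<gamma> / Q - z * (\<alpha> * \<beta>)) * (1 - z * Q) * (poch_inf (z * Q ^ 2) * heine_cont \<alpha> \<beta> \<gamma> (z * Q ^ 2))"
proof -
  have "z \<noteq> 1" using assms by auto
  have 1: "poch_inf z = (1 - z) * poch_inf (z * Q)" by (rule poch_inf_step)
  have 2: "poch_inf (z * Q) = (1 - z * Q) * poch_inf (z * Q ^ 2)"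
    using poch_inf_step[of "z * Q"] by (simp add: power2_eq_square mult.assoc)
  have "poch_inf z * heine_cont \<alpha> \<beta> \<gamma> z = poch_inf (z * Q) * ((1 - z) * heine_cont \<alpha> \<beta> \<gamma> z)"
    by (simp add: 1)
  also have "\<dots> = (1 + \<gamma> / Q - z * (\<alpha> + \<beta>)) * (poch_inf (z * Q) * heine_cont \<alpha> \<beta> \<gamma> (z * Q))
    - (\<gamma> / Q - z * (\<alpha> * \<beta>)) * (poch_inf (z * Q) * heine_cont \<alpha> \<beta> \<gamma> (z * Q ^ 2))"
    unfolding heine_cont_equation[OF \<open>z \<noteq> 1\<close>] by (simp add: algebra_simps)
  finally show ?thesis by (simp only: 2 mult_ac)
qed

text \<open>Under \<open>z \<mapsto> w = \<alpha>\<beta>z/\<gamma>\<close>, \<open>\<alpha> \<mapsto> \<gamma>/\<alpha>\<close>, \<open>\<beta> \<mapsto> \<gamma>/\<beta>\<close> the quantity \<open>z(\<alpha> + \<beta>)\<close> is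
invariant, while \<open>1 - zq\<close> and \<open>1 - wq = 1 - \<alpha>\<beta>zq/\<gamma>\<close> are exchanged. So both sides satisfy the same equation
\<open>entire_heine_equation\<close>. They agree at \<open>0\<close>, hence near \<open>0\<close>, hence everywhere.\<close>

theorem heine_euler_transformation:
  assumes "\<alpha> \<noteq> 0" "\<beta> \<noteq> 0" "\<gamma> \<noteq> 0" and \<gamma>: "\<gamma> \<notin> poles"
    and "z \<notin> poles" and "\<alpha> * \<beta> / \<gamma> * z \<notin> poles"
  shows "poch_inf z * heine_cont \<alpha> \<beta> \<gamma> z =
    poch_inf (\<alpha> * \<beta> / \<gamma> * z) * heine_cont (\<gamma> / \<alpha>) (\<gamma> / \<beta>) \<gamma> (\<alpha> * \<beta> / \<gamma> * z)"
proof -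
  define k where "k = \<alpha> * \<beta> / \<gamma>"
  define d where "d = (\<lambda>z. poch_inf z * heine_cont \<alpha> \<beta> \<gamma> z -
    poch_inf (k * z) * heine_cont (\<gamma> / \<alpha>) (\<gamma> / \<beta>) \<gamma> (k * z))"
  define A where "A = (\<lambda>z. 1 + \<gamma> / Q - z * (\<alpha> + \<beta>))"
  define B where "B = (\<lambda>z. \<gamma> / Q * (1 - k * z * Q) * (1 - z * Q))"
  have d_eq: "d w = A w * d (w * Q) - B w * d (w * Q ^ 2)" if w: "w \<notin> poles" "k * w \<notin> poles" for w
  proof -
    have 1: "poch_inf w * heine_cont \<alpha> \<beta> \<gamma> w =
      A w * (poch_inf (w * Q) * heine_cont \<alpha> \<beta> \<gamma> (w * Q))
      - B w * (poch_inf (w * Q ^ 2) * heine_cont \<alpha> \<beta> \<gamma> (w * Q ^ 2))"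
    proof -
      have "(\<gamma> / Q - w * (\<alpha> * \<beta>)) * (1 - w * Q) = B w"
        using assms(3) by (simp add: B_def k_def field_simps)
      thus ?thesis using entire_heine_equation[OF w(1), of \<alpha> \<beta> \<gamma>] by (simp add: A_def)
    qed
    have 2: "poch_inf (k * w) * heine_cont (\<gamma> / \<alpha>) (\<gamma> / \<beta>) \<gamma> (k * w) =
      A w * (poch_inf (k * (w * Q)) * heine_cont (\<gamma> / \<alpha>) (\<gamma> / \<beta>) \<gamma> (k * (w * Q)))
      - B w * (poch_inf (k * (w * Q ^ 2)) * heine_cont (\<gamma> / \<alpha>) (\<gamma> / \<beta>) \<gamma> (k * (w * Q ^ 2)))"
    proof -
      have "(\<gamma> / Q - k * w * (\<gamma> / \<alpha> * (\<gamma> / \<beta>))) * (1 - k * w * Q) = B w"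
        using assms(1-3) by (simp add: B_def k_def field_simps)
      moreover have "1 + \<gamma> / Q - k * w * (\<gamma> / \<alpha> + \<gamma> / \<beta>) = A w"
        using assms(1-3) by (simp add: A_def k_def field_simps)
      ultimately show ?thesis
        using entire_heine_equation[OF w(2), of "\<gamma> / \<alpha>" "\<gamma> / \<beta>" \<gamma>] by (simp add: mult.assoc)
    qed
    show ?thesis unfolding d_def 1 2 by (simp only: ring_distribs) simp
  qed
  \<comment> \<open>small enough to keep both arguments in the unit disc\<close>
  define r where "r = 1 / (1 + norm k)"
  have r: "0 < r" by (simp add: r_def add_pos_nonneg)
  have small: "norm w < 1 \<and> norm (k * w) < 1" if "norm w < r" for w
  proof -
    have "norm w * (1 + norm k) < 1"
      using that by (simp add: r_def pos_less_divide_eq add_pos_nonneg)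
    hence "norm w + norm k * norm w < 1" by (simp add: algebra_simps)
    moreover have "0 \<le> norm w" "0 \<le> norm k * norm w" by simp_all
    ultimately have "norm w < 1" "norm k * norm w < 1" by linarith+
    thus ?thesis by (simp add: norm_mult)
  qed
  have "d holomorphic_on ball 0 r"
  proof -
    have images: "(\<lambda>z. k * z) ` ball 0 r \<subseteq> ball 0 1" "ball (0 :: complex) r \<subseteq> ball 0 1"
      using small by auto
    have "(\<lambda>z. heine_cont (\<gamma> / \<alpha>) (\<gamma> / \<beta>) \<gamma> (k * z)) holomorphic_on ball 0 r"
      by (rule holomorphic_on_compose_gen[unfolded o_def, OF _ heine_cont_holomorphic_ball images(1)])
         (auto intro!: holomorphic_intros)
    moreover have "heine_cont \<alpha> \<beta> \<gamma> holomorphic_on ball 0 r"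
      using heine_cont_holomorphic_ball images(2) by (rule holomorphic_on_subset)
    moreover have "(\<lambda>z. poch_inf (k * z)) holomorphic_on ball 0 r"
      by (rule holomorphic_on_compose_gen[unfolded o_def, OF _ poch_inf_holomorphic])
         (auto intro!: holomorphic_intros)
    moreover have "poch_inf holomorphic_on ball 0 r"
      using poch_inf_holomorphic by (rule holomorphic_on_subset) simp
    ultimately show ?thesis unfolding d_def by (intro holomorphic_intros)
  qed
  moreover have "d 0 = 0" by (simp add: d_def)
  moreover have "isCont A 0" "isCont B 0"
    unfolding A_def B_def by (intro continuous_intros; simp)+
  moreover have "d w = A w * d (w * Q) - B w * d (w * Q ^ 2)" if "norm w < r" for w
    using small[OF that] by (intro d_eq norm_less_1_notin_poles) auto
  moreover have "1 - A 0 * Q ^ n + B 0 * (Q ^ n) ^ 2 \<noteq> 0" if "n > 0" for n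
  proof -
    obtain m where m: "n = Suc m" using \<open>n > 0\<close> by (cases n) auto
    have "1 - A 0 * Q ^ n + B 0 * (Q ^ n) ^ 2 = (1 - Q ^ n) * (1 - \<gamma> * Q ^ m)"
      unfolding m by (simp add: A_def B_def field_simps power2_eq_square)
    moreover have "\<gamma> * Q ^ m \<noteq> 1" using \<gamma> unfolding poles_eq by auto
    ultimately show ?thesis using Q_power_neq_1[OF that] by simp
  qed
  ultimately have d_small: "d w = 0" if "norm w < r" for w
    using analytic_solution_vanishes[of d r A B] r that by blast
  have "d z = 0"
  proof (rule q_descent[where r = r and R = "\<lambda>z. z \<notin> poles \<and> k * z \<notin> poles" and P = "\<lambda>z. d z = 0"])
    show "w * Q \<notin> poles \<and> k * (w * Q) \<notin> poles" if "w \<notin> poles \<and> k * w \<notin> poles" for w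
      using that mult_Q_notin_poles[of w] mult_Q_notin_poles[of "k * w"] by (simp add: mult.assoc)
    show "d w = 0" if "w \<notin> poles \<and> k * w \<notin> poles" "d (w * Q) = 0" "d (w * Q ^ 2) = 0" for w
      using that d_eq[of w] by simp
  qed (use assms r d_small in \<open>auto simp: k_def\<close>)
  thus ?thesis by (simp add: d_def k_def)
qed

section \<open>Factorization of the operator\<close>

text \<open>Taking out \<open>- q\<^sup>i\<^sup>+\<^sup>1\<^sup>-\<^sup>k/s\<close> from the factors of \<open>(q\<^sup>1\<^sup>-\<^sup>k/s)\<^sub>j\<close> leaves the last \<open>j\<close> factors of
\<open>(s)\<^sub>k\<close> in reversed order. Apart from \<open>s\<^sup>j\<close>, the product of what is taken out does not depend on \<open>s\<close>.\<close>

lemma poch_reversal: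
  assumes "j \<le> k" and "s \<noteq> 0"
  shows "poch (Q / (s * Q ^ k)) j * s ^ j * poch s (k - j) =
    poch s k * (\<Prod>i<j. - (Q ^ Suc i) / Q ^ k)"
  using assms(1)
proof (induction j)
  case (Suc j)
  define m where "m = k - Suc j"
  have k: "k - j = Suc m" "Q ^ k = Q ^ Suc j * Q ^ m"
    using Suc.prems by (auto simp: m_def power_add[symmetric] simp del: power_Suc)
  have factor: "(1 - Q / (s * Q ^ k) * Q ^ j) * s = - (Q ^ Suc j) / Q ^ k * (1 - s * Q ^ m)"
    using assms(2) by (simp add: k(2) field_simps)
  have "poch (Q / (s * Q ^ k)) (Suc j) * s ^ Suc j * poch s m =
    (poch (Q / (s * Q ^ k)) j * s ^ j) * ((1 - Q / (s * Q ^ k) * Q ^ j) * s) * poch s m"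
    by (simp only: poch_Suc power_Suc mult_ac)
  also have "\<dots> = (poch (Q / (s * Q ^ k)) j * s ^ j) * (- (Q ^ Suc j) / Q ^ k * (1 - s * Q ^ m)) * poch s m"
    unfolding factor ..
  also have "\<dots> = poch (Q / (s * Q ^ k)) j * s ^ j * poch s (Suc m) * (- (Q ^ Suc j) / Q ^ k)"
    by (simp only: poch_Suc mult_ac)
  also have "\<dots> = poch s k * (\<Prod>i<Suc j. - (Q ^ Suc i) / Q ^ k)"
    using Suc by (simp add: k(1))
  finally show ?case by (simp only: m_def)
qed simp

text \<open>The \<open>s\<close>-independent product cancels in the quotient of the cases \<open>s = q\<close> and general \<open>s\<close> of
\<open>poch_reversal\<close>. This exhibits the weights of the terminating series as a convolution.\<close>

lemma phi32_weight:
  assumes "j \<le> k" and s: "s \<noteq> 0" "s \<notin> poles"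
  shows "poch s k / poch Q k * (poch (1 / Q ^ k) j / poch (Q / (s * Q ^ k)) j * Q ^ j) =
    s ^ j * binom_coeff s (k - j)"
proof -
  define R where "R = (\<Prod>i<j. - (Q ^ Suc i) / Q ^ k)"
  have R: "R \<noteq> 0" by (simp add: R_def)
  have 1: "poch (Q / (s * Q ^ k)) j * s ^ j * poch s (k - j) = poch s k * R"
    unfolding R_def using assms by (intro poch_reversal)
  have 2: "poch (1 / Q ^ k) j * Q ^ j * poch Q (k - j) = poch Q k * R"
    unfolding R_def using poch_reversal[OF assms(1), of Q] by simp
  have nz: "poch (Q / (s * Q ^ k)) j \<noteq> 0"
    using 1 R poch_nonzero[OF s(2), of k] by auto
  have "poch s k * (poch (1 / Q ^ k) j * Q ^ j * poch Q (k - j)) * R =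
    poch Q k * (poch (Q / (s * Q ^ k)) j * s ^ j * poch s (k - j)) * R"
    unfolding 1 2 by (simp only: mult_ac)
  hence "poch s k * (poch (1 / Q ^ k) j * Q ^ j * poch Q (k - j)) =
    poch Q k * (poch (Q / (s * Q ^ k)) j * s ^ j * poch s (k - j))"
    using R by simp
  thus ?thesis using nz by (simp add: binom_coeff_def field_simps)
qed

text \<open>The operator \<open>A\<^sub>0\<^sub>,\<^sub>\<mu>\<close>, with \<open>t = q\<^sup>\<mu>\<close> and \<open>c\<close> for the product of the two parameters.\<close>

definition A_mu :: "complex \<Rightarrow> complex \<Rightarrow> (complex \<Rightarrow> complex) \<Rightarrow> complex \<Rightarrow> complex" where
  "A_mu t c f x = (\<Sum>j. binom_coeff t j * c ^ j * f (x * t * Q ^ j))"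

definition nu_kernel :: "complex \<Rightarrow> complex \<Rightarrow> complex \<Rightarrow> complex \<Rightarrow> nat \<Rightarrow> complex" where
  "nu_kernel s a b y m = binom_coeff s m * (a * b) ^ m * poch (- y) m
     * poch_inf (- b * y / a * Q ^ m) / poch_inf (- b * y / (a * s))"

text \<open>The operator \<open>A\<^sub>\<nu>\<^sub>,\<^sub>0(a,b)\<close>, with \<open>s = q\<^sup>\<nu>\<close>.\<close>

definition A_nu ::
    "complex \<Rightarrow> complex \<Rightarrow> complex \<Rightarrow> (complex \<Rightarrow> complex) \<Rightarrow> complex \<Rightarrow> complex" where
  "A_nu s a b f y = (\<Sum>m. nu_kernel s a b y m * f (y * Q ^ m))"

text \<open>By \<open>phi32_weight\<close>, the \<open>k\<close>-th term is a sum over \<open>j + m = k\<close> of terms \<open>h j m\<close> of size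
at most a constant times \<open>|abs|\<^sup>j |ab|\<^sup>m\<close>. Rearranging gives the composition. Only the values of \<open>f\<close> on one
orbit enter, so boundedness is needed only there.\<close>

lemma A_factorization:
  fixes s t a b x :: complex and f :: "complex \<Rightarrow> complex"
  assumes s: "s \<noteq> 0" "s \<notin> poles"
    and ab: "norm (a * b) < 1" "norm (a * b * s) < 1"
    and X: "- x * t \<notin> poles" and \<beta>: "- b * x * t / a \<notin> poles" "- b * x * t / (a * s) \<notin> poles"
    and f: "\<And>k. norm (f (x * t * Q ^ k)) \<le> F"
  defines "S \<equiv> (\<lambda>k. f (x * t * Q ^ k) * (a * b) ^ k * (poch s k * poch (- x * t) k)
      / (poch Q k * poch (- b * x * t / a) k)
      * phi32 q k t (- b * x * t / (a * s)) (Q / (s * Q ^ k)) (- x * t))"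
  shows "summable S"
    and "poch_inf (- b * x * t / a) / poch_inf (- b * x * t / (a * s)) * (\<Sum>k. S k) =
      A_mu t (a * b * s) (A_nu s a b f) x"
proof -
  define \<xi> where "\<xi> = - x * t"
  define \<beta>' where "\<beta>' = - b * x * t / a"
  have \<beta>s: "- b * x * t / (a * s) = \<beta>' / s" by (simp add: \<beta>'_def)
  have np: "\<xi> \<notin> poles" "\<beta>' \<notin> poles" "\<beta>' / s \<notin> poles"
    using X \<beta> by (auto simp: \<xi>_def \<beta>'_def)
  have nz: "poch \<xi> j \<noteq> 0" "poch \<beta>' j \<noteq> 0" "poch (\<beta>' / s) j \<noteq> 0" "poch_inf \<beta>' \<noteq> 0" "poch_inf (\<beta>' / s) \<noteq> 0" for j
    using np poch_nonzero poch_inf_eq_0_iff by blast+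
  define h where "h = (\<lambda>j m. binom_coeff t j * (a * b * s) ^ j *
    (nu_kernel s a b (x * t * Q ^ j) m * f (x * t * Q ^ j * Q ^ m)))"
  have kernel: "nu_kernel s a b (x * t * Q ^ j) m = binom_coeff s m * (a * b) ^ m * (poch \<xi> (j + m) / poch \<xi> j)
     * poch_inf (\<beta>' * Q ^ (j + m)) * poch (\<beta>' / s) j / poch_inf (\<beta>' / s)" for j m
  proof -
    have e: "- (x * t * Q ^ j) = \<xi> * Q ^ j" "- b * (x * t * Q ^ j) / a * Q ^ m = \<beta>' * Q ^ (j + m)"
      "- b * (x * t * Q ^ j) / (a * s) = \<beta>' / s * Q ^ j"
      by (simp_all add: \<xi>_def \<beta>'_def power_add)
    have "poch (\<xi> * Q ^ j) m = poch \<xi> (j + m) / poch \<xi> j"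
      using nz(1)[of j] by (simp add: poch_add)
    moreover have "1 / poch_inf (\<beta>' / s * Q ^ j) = poch (\<beta>' / s) j / poch_inf (\<beta>' / s)"
      using nz(3)[of j] nz(5) poch_inf_split[of "\<beta>' / s" j] by (simp add: field_simps)
    ultimately show ?thesis
      unfolding nu_kernel_def e by (simp only: divide_inverse mult_ac mult_1_left mult_1_right)
  qed
  obtain M1 where M1: "M1 > 0" "\<And>j. norm (binom_coeff t j) \<le> M1" using binom_coeff_bounded by blast
  obtain M2 where M2: "M2 > 0" "\<And>j. norm (binom_coeff s j) \<le> M2" using binom_coeff_bounded by blast
  obtain M3 where M3: "M3 > 0" "\<And>j. norm (poch \<xi> j) \<le> M3" using poch_bounded by blast
  obtain M4 where M4: "M4 > 0" "\<And>j. norm (poch (\<beta>' / s) j / poch \<xi> j) \<le> M4"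
    using poch_ratio_bounded[OF np(1)] by blast
  obtain M5 where M5: "M5 > 0" "\<And>y. norm y \<le> norm \<beta>' \<Longrightarrow> norm (poch_inf y) \<le> M5"
    using poch_inf_bounded by blast
  define C where "C = M2 * M3 * M5 * M4 * norm (1 / poch_inf (\<beta>' / s)) * F"
  have F: "F \<ge> 0" using f[of 0] norm_ge_zero order_trans by blast
  have bound: "norm (h j m) \<le> (M1 * norm (a * b * s) ^ j) * (C * norm (a * b) ^ m)" for j m
  proof -
    have "h j m = (binom_coeff t j * (a * b * s) ^ j) * (binom_coeff s m * poch \<xi> (j + m) *
      poch_inf (\<beta>' * Q ^ (j + m)) * (poch (\<beta>' / s) j / poch \<xi> j) * (1 / poch_inf (\<beta>' / s)) *
      f (x * t * Q ^ (j + m)) * (a * b) ^ m)"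
      unfolding h_def kernel by (simp add: power_add mult_ac)
    also have "norm \<dots> = (norm (binom_coeff t j) * norm (a * b * s) ^ j) * (norm (binom_coeff s m) *
      norm (poch \<xi> (j + m)) * norm (poch_inf (\<beta>' * Q ^ (j + m))) * norm (poch (\<beta>' / s) j / poch \<xi> j) *
      norm (1 / poch_inf (\<beta>' / s)) * norm (f (x * t * Q ^ (j + m))) * norm (a * b) ^ m)"
      by (simp only: norm_mult norm_power)
    also have "\<dots> \<le> (M1 * norm (a * b * s) ^ j) * (C * norm (a * b) ^ m)"
      unfolding C_def using M1 M2 M3 M4 M5 F f norm_mult_Q_power_le
      by (intro mult_mono order_refl mult_nonneg_nonneg norm_ge_zero zero_le_power) (auto intro: less_imp_le)
    finally show ?thesis .
  qed
  have C: "C \<ge> 0" unfolding C_def using M2 M3 M4 M5 F by simp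
  have A: "summable (\<lambda>j. M1 * norm (a * b * s) ^ j)" "\<And>j. 0 \<le> M1 * norm (a * b * s) ^ j"
    and B: "summable (\<lambda>m. C * norm (a * b) ^ m)" "\<And>m. 0 \<le> C * norm (a * b) ^ m"
    using ab M1(1) C by (auto intro!: summable_mult summable_geometric simp del: norm_mult)
  note rearr = double_series_rearrangement[OF bound A B]
  have diag: "(\<Sum>j\<le>k. h j (k - j)) = poch_inf \<beta>' / poch_inf (\<beta>' / s) * S k" for k
  proof -
    define c where "c = f (x * t * Q ^ k) * (a * b) ^ k * poch \<xi> k * poch_inf (\<beta>' * Q ^ k) / poch_inf (\<beta>' / s)"
    have "h j (k - j) = c * (poch s k / poch Q k * ((poch (1 / Q ^ k) j * poch t j * poch (\<beta>' / s) j)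
        / (poch Q j * poch (Q / (s * Q ^ k)) j * poch \<xi> j) * Q ^ j))" if "j \<le> k" for j
    proof -
      have "(a * b) ^ j * (a * b) ^ (k - j) = (a * b) ^ k"
        using that by (simp add: power_add[symmetric])
      hence e: "j + (k - j) = k" "(a * b * s) ^ j * (a * b) ^ (k - j) = (a * b) ^ k * s ^ j"
        using that by (simp_all add: power_mult_distrib[of "a * b" s])
      have "h j (k - j) = (c * (binom_coeff t j * (poch (\<beta>' / s) j / poch \<xi> j))) * (s ^ j * binom_coeff s (k - j))"
      proof -
        have "h j (k - j) = binom_coeff t j * (binom_coeff s (k - j) * (poch \<xi> k / poch \<xi> j)
            * poch_inf (\<beta>' * Q ^ k) * poch (\<beta>' / s) j / poch_inf (\<beta>' / s)) * f (x * t * Q ^ k)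
            * ((a * b * s) ^ j * (a * b) ^ (k - j))"
          unfolding h_def kernel e(1) using that by (simp add: power_add[symmetric] mult_ac)
        thus ?thesis unfolding e by (simp add: c_def mult_ac)
      qed
      also have "\<dots> = (c * (binom_coeff t j * (poch (\<beta>' / s) j / poch \<xi> j))) *
        (poch s k / poch Q k * (poch (1 / Q ^ k) j / poch (Q / (s * Q ^ k)) j * Q ^ j))"
        using phi32_weight[OF that s] by simp
      finally show ?thesis by (simp add: binom_coeff_def mult_ac)
    qed
    hence "(\<Sum>j\<le>k. h j (k - j)) = c * (poch s k / poch Q k * phi32 q k t (\<beta>' / s) (Q / (s * Q ^ k)) \<xi>)"
      unfolding phi32_def sum_distrib_left by (intro sum.cong) auto
    also have "c = poch_inf \<beta>' / poch_inf (\<beta>' / s) * (f (x * t * Q ^ k) * (a * b) ^ k * poch \<xi> k / poch \<beta>' k)"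
      using nz(2)[of k] poch_inf_split[of \<beta>' k] by (simp add: c_def)
    finally show ?thesis
      unfolding S_def \<beta>s \<xi>_def[symmetric] \<beta>'_def[symmetric] by (simp add: mult_ac)
  qed
  have row: "(\<Sum>m. h j m) = binom_coeff t j * (a * b * s) ^ j * A_nu s a b f (x * t * Q ^ j)" for j
  proof (cases "binom_coeff t j * (a * b * s) ^ j = 0")
    case False
    hence "summable (\<lambda>m. nu_kernel s a b (x * t * Q ^ j) m * f (x * t * Q ^ j * Q ^ m))"
      using rearr(3)[of j] unfolding h_def by (subst (asm) summable_cmult_iff) auto
    thus ?thesis unfolding h_def A_nu_def by (rule suminf_mult)
  next
    case True
    thus ?thesis unfolding h_def by (simp only: mult_zero_left suminf_zero)
  qed
  have "(\<lambda>k. poch_inf \<beta>' / poch_inf (\<beta>' / s) * S k) sums A_mu t (a * b * s) (A_nu s a b f) x"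
    using rearr(2) unfolding diag row A_mu_def .
  hence sm: "summable (\<lambda>k. poch_inf \<beta>' / poch_inf (\<beta>' / s) * S k)"
    and sm': "(\<Sum>k. poch_inf \<beta>' / poch_inf (\<beta>' / s) * S k) = A_mu t (a * b * s) (A_nu s a b f) x"
    by (simp_all only: sums_iff)
  have "poch_inf \<beta>' / poch_inf (\<beta>' / s) \<noteq> 0" using nz by simp
  hence "summable S" using sm by (subst (asm) summable_cmult_iff) auto
  with sm' have "summable S" "poch_inf \<beta>' / poch_inf (\<beta>' / s) * (\<Sum>k. S k) = A_mu t (a * b * s) (A_nu s a b f) x"
    by (simp_all only: suminf_mult)
  thus "summable S" and "poch_inf (- b * x * t / a) / poch_inf (- b * x * t / (a * s)) * (\<Sum>k. S k) =
      A_mu t (a * b * s) (A_nu s a b f) x"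
    unfolding \<beta>s \<beta>'_def[symmetric] by auto
qed

section \<open>Intertwining relations\<close>

text \<open>The coefficients \<open>l1\<close>, \<open>l2\<close>, \<open>l3\<close> are those of the operator on the left at \<open>x\<close>, and \<open>p j\<close>,
\<open>r j\<close>, \<open>s j\<close> are their differences from the coefficients of the operator on the right at \<open>xtq\<^sup>j\<close>, weighted by
\<open>e j\<close>. The recursion for \<open>e\<close> says \<open>p j = s (j + 1)\<close>, and \<open>p j + r j + s j = 0\<close> because constants are
eigenfunctions of both operators with the same eigenvalue.\<close>

lemma A_mu_intertwines:
  assumes nz: "x \<noteq> 0" "t \<noteq> 0" "a \<noteq> 0" "b \<noteq> 0"
    and zero: "\<And>n. n \<ge> N \<Longrightarrow> f (x * t * Q ^ n) = 0"
  shows "L_op q a (b * t) (A_mu t (a * b) f) x = A_mu t (a * b) (L_op q a b f) x"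
proof -
  \<comment> \<open>indexed so that \<open>u 0\<close> is the value at \<open>xt/q\<close>, the extra point reached by the difference operator\<close>
  define u where "u = (\<lambda>n. f (x * t * Q ^ n / Q))"
  define e where "e = (\<lambda>j. binom_coeff t j * (a * b) ^ j)"
  have u0: "u n = 0" if "n \<ge> Suc N" for n
  proof -
    define n' where "n' = n - 1"
    have n: "n = Suc n'" "n' \<ge> N" using that by (auto simp: n'_def)
    have "x * t * Q ^ n / Q = x * t * Q ^ n'" by (simp add: n(1))
    thus ?thesis unfolding u_def using zero[OF n(2)] by (simp only:)
  qed
  have summ: "summable (\<lambda>j. e j * u (j + k))" for k
    using u0 by (rule summable_of_eventually_zero)
  have e_Suc: "e (Suc j) * (1 - Q ^ Suc j) = e j * (a * b * (1 - t * Q ^ j))" for j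
      unfolding e_def by (rule binom_coeff_power_Suc)
  have A: "A_mu t (a * b) f (Q * x) = (\<Sum>j. e j * u (j + 2))" "A_mu t (a * b) f x = (\<Sum>j. e j * u (j + 1))"
    "A_mu t (a * b) f (x / Q) = (\<Sum>j. e j * u j)"
    by (simp_all add: A_mu_def e_def u_def mult_ac)
  define l1 where "l1 = a / 2 * (1 + 1 / x)"
  define l2 where "l2 = a / (2 * x) + Q / (2 * (b * t) * x)"
  define l3 where "l3 = 1 / (2 * a) * (1 + a * Q / (b * t * x))"
  define s where "s = (\<lambda>j. e j * (Q / (2 * b * t * x) * (1 - 1 / Q ^ j)))"
  define r where "r = (\<lambda>j. - (e j * ((a / 2 + Q / (2 * b * t)) / x - (a / 2 + Q / (2 * b)) / (x * t * Q ^ j))))"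
  define p where "p = (\<lambda>j. e j * (a / (2 * x) * (1 - 1 / (t * Q ^ j))))"
  have p_eq: "p j = s (Suc j)" for j
  proof -
    have "s (Suc j) = - (e (Suc j) * (1 - Q ^ Suc j)) * (Q / (2 * b * t * x) / Q ^ Suc j)"
      using nz by (simp add: s_def field_simps)
    also have "\<dots> = p j"
      unfolding e_Suc using nz by (simp add: p_def field_simps)
    finally show ?thesis ..
  qed
  have psr: "p j + r j + s j = 0" for j
  proof -
    have "p j + r j + s j = e j * (a / (2 * x) * (1 - 1 / (t * Q ^ j)) -
      ((a / 2 + Q / (2 * b * t)) / x - (a / 2 + Q / (2 * b)) / (x * t * Q ^ j)) +
      Q / (2 * b * t * x) * (1 - 1 / Q ^ j))"
      by (simp only: p_def r_def s_def ring_distribs) simp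
    also have "a / (2 * x) * (1 - 1 / (t * Q ^ j)) -
      ((a / 2 + Q / (2 * b * t)) / x - (a / 2 + Q / (2 * b)) / (x * t * Q ^ j)) +
      Q / (2 * b * t * x) * (1 - 1 / Q ^ j) = 0"
      using nz by (simp add: field_simps)
    finally show ?thesis by simp
  qed
  have tel: "(\<lambda>j. p j * u (j + 2) + r j * u (j + 1) + s j * u j) sums 0"
  proof (rule three_term_telescope_sums)
    show "s 0 = 0" by (simp add: s_def)
    thus "r 0 + s 1 = 0" using psr[of 0] p_eq[of 0] by (simp add: add.commute)
    show "p n + r (Suc n) + s (n + 2) = 0" for n
      using psr[of "Suc n"] p_eq[of n] p_eq[of "Suc n"] by (simp add: add_ac)
    have "p n * u (n + 2) - s (n + 1) * u (n + 1) = 0" if "n \<ge> Suc N" for n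
      using u0 that by simp
    thus "(\<lambda>n. p n * u (n + 2) - s (n + 1) * u (n + 1)) \<longlonglongrightarrow> 0"
      by (intro tendsto_eventually eventually_sequentiallyI[of "Suc N"])
  qed
  have termwise: "e j * L_op q a b f (x * t * Q ^ j) =
    l1 * (e j * u (j + 2)) - l2 * (e j * u (j + 1)) + l3 * (e j * u (j + 0))
    - (p j * u (j + 2) + r j * u (j + 1) + s j * u j)" for j
  proof -
    have L: "L_op q a b f (x * t * Q ^ j) = a / 2 * (1 + 1 / (x * t * Q ^ j)) * u (j + 2)
      - (a / (2 * (x * t * Q ^ j)) + Q / (2 * b * (x * t * Q ^ j))) * u (j + 1)
      + 1 / (2 * a) * (1 + a * Q / (b * (x * t * Q ^ j))) * u j"
      by (simp add: L_op_def u_def mult_ac)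
    have c1: "p j = e j * (l1 - a / 2 * (1 + 1 / (x * t * Q ^ j)))"
      unfolding p_def l1_def using nz by (simp add: field_simps)
    have c2: "r j = e j * (a / (2 * (x * t * Q ^ j)) + Q / (2 * b * (x * t * Q ^ j)) - l2)"
      unfolding r_def l2_def using nz by (simp add: field_simps)
    have c3: "s j = e j * (l3 - 1 / (2 * a) * (1 + a * Q / (b * (x * t * Q ^ j))))"
      unfolding s_def l3_def using nz by (simp add: field_simps)
    show ?thesis unfolding L c1 c2 c3 by (simp add: algebra_simps)
  qed
  have "(\<lambda>j. e j * L_op q a b f (x * t * Q ^ j)) sums
    (l1 * (\<Sum>j. e j * u (j + 2)) - l2 * (\<Sum>j. e j * u (j + 1)) + l3 * (\<Sum>j. e j * u (j + 0)) - 0)"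
    unfolding termwise by (intro sums_add sums_diff sums_mult summable_sums summ tel)
  thus ?thesis
    by (simp add: sums_iff L_op_def[of q a "b * t"] A l1_def l2_def l3_def A_mu_def[of t _ "L_op q a b f"] e_def)
qed

text \<open>Here the kernel depends on the point, and the left-hand side needs it at \<open>qy\<close>, \<open>y\<close> and \<open>y/q\<close>.
The factors \<open>1 + 1/y\<close> and \<open>1 + asq/(by)\<close> of the difference operator complete the shifted factorials in these
kernels, so that all three have the denominator \<open>W = (-by/(as))\<^sub>\<infinity>\<close>. The differences \<open>p\<close>, \<open>r\<close>, \<open>\<sigma>\<close> of
coefficients then become sums of products of one sequence \<open>g\<close> with \<open>X m V m = (-y)\<^sub>m (-byq\<^sup>m/a)\<^sub>\<infinity>\<close>.\<close>

lemma A_nu_intertwines: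
  assumes nz: "y \<noteq> 0" "s \<noteq> 0" "a \<noteq> 0" "b \<noteq> 0"
    and np: "- b * y / (a * s) / Q \<notin> poles"
    and zero: "\<And>n. n \<ge> N \<Longrightarrow> f (y * Q ^ n) = 0"
  shows "L_op q (a * s) b (A_nu s a b f) y = A_nu s a b (L_op q a b f) y"
proof -
  define \<beta> where "\<beta> = - b * y / a"
  define W where "W = poch_inf (\<beta> / s)"
  define X where "X = (\<lambda>m. poch (- y) m)"
  define V where "V = (\<lambda>m. poch_inf (\<beta> * Q ^ m))"
  define e where "e = (\<lambda>m. binom_coeff s m * (a * b) ^ m)"
  define u where "u = (\<lambda>n. f (y * Q ^ n / Q))"
  define g where "g = (\<lambda>n. - (e n * (a * (1 - s * Q ^ n))) / (2 * W * y * Q ^ n))"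
  have np': "\<beta> / s / Q \<notin> poles" using np by (simp add: \<beta>_def)
  have np'': "\<beta> / s \<notin> poles" using mult_Q_notin_poles[OF np'] by simp
  have W: "W \<noteq> 0" using np'' poch_inf_eq_0_iff by (simp add: W_def)
  have W1: "W = (1 - \<beta> / s) * poch_inf (\<beta> / s * Q)" unfolding W_def by (rule poch_inf_step)
  have W2: "poch_inf (\<beta> / s / Q) = (1 - \<beta> / s / Q) * W"
    using poch_inf_step[of "\<beta> / s / Q"] by (simp add: W_def)
  have ne: "1 - \<beta> / s \<noteq> 0" "1 - \<beta> / s / Q \<noteq> 0" using np' np'' by auto
  have X_Suc: "X (Suc m) = X m * (1 + y * Q ^ m)" for m by (simp add: X_def poch_Suc)
  have V_step: "V m = (1 - \<beta> * Q ^ m) * V (Suc m)" for m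
    using poch_inf_step[of "\<beta> * Q ^ m"] by (simp add: V_def mult_ac)
  have V_pred: "poch_inf (\<beta> * Q ^ m / Q) = (1 - \<beta> * Q ^ m / Q) * V m" for m
    using poch_inf_step[of "\<beta> * Q ^ m / Q"] by (simp add: V_def)
  have e_Suc: "e (Suc j) * (1 - Q ^ Suc j) = e j * (a * b * (1 - s * Q ^ j))" for j
      unfolding e_def by (rule binom_coeff_power_Suc)
  have u0: "u n = 0" if "n \<ge> Suc N" for n
  proof -
    define n' where "n' = n - 1"
    have n: "n = Suc n'" "n' \<ge> N" using that by (auto simp: n'_def)
    have "y * Q ^ n / Q = y * Q ^ n'" by (simp add: n(1))
    thus ?thesis unfolding u_def using zero[OF n(2)] by (simp only:)
  qed
  have summ: "summable (\<lambda>j. c j * u (j + k))" for c k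
    using u0 by (rule summable_of_eventually_zero)
  define d where "d = (\<lambda>m. e m * X m * V m / W)"
  define d1 where "d1 = (\<lambda>m. nu_kernel s a b (Q * y) m)"
  define d3 where "d3 = (\<lambda>m. nu_kernel s a b (y / Q) m)"
  have d: "nu_kernel s a b y m = d m" for m
    by (simp add: nu_kernel_def d_def e_def X_def V_def W_def \<beta>_def)
  have d1: "(1 + y) * d1 m = e m * X (Suc m) * V (Suc m) * (1 - \<beta> / s) / W" for m
  proof -
    have "d1 m = e m * poch (- y * Q) m * V (Suc m) / poch_inf (\<beta> / s * Q)"
      by (simp add: d1_def nu_kernel_def e_def V_def \<beta>_def mult_ac)
    moreover have "X (Suc m) = (1 + y) * poch (- y * Q) m"
      unfolding X_def by (simp add: poch_Suc_shift)
    ultimately have "(1 + y) * d1 m = e m * X (Suc m) * V (Suc m) * (1 / poch_inf (\<beta> / s * Q))"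
      by (simp only: divide_inverse mult_ac mult_1_left)
    also have "1 / poch_inf (\<beta> / s * Q) = (1 - \<beta> / s) / W"
      using ne(1) unfolding W1 by simp
    finally show ?thesis by simp
  qed
  have d3: "(1 - \<beta> / s / Q) * d3 m = e m * poch (- y / Q) m * poch_inf (\<beta> * Q ^ m / Q) / W" for m
  proof -
    have "d3 m = e m * poch (- y / Q) m * poch_inf (\<beta> * Q ^ m / Q) / poch_inf (\<beta> / s / Q)"
      by (simp add: d3_def nu_kernel_def e_def \<beta>_def mult_ac)
    thus ?thesis unfolding W2 using ne(2) by (simp only: times_divide_eq_right mult_divide_mult_cancel_left[OF ne(2)])
  qed
  have A: "A_nu s a b f (Q * y) = (\<Sum>j. d1 j * u (j + 2))" "A_nu s a b f y = (\<Sum>j. d j * u (j + 1))"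
    "A_nu s a b f (y / Q) = (\<Sum>j. d3 j * u j)"
    by (simp_all add: A_nu_def d1_def d3_def d u_def mult_ac)
  define l1 where "l1 = a * s / 2 * (1 + 1 / y)"
  define l2 where "l2 = a * s / (2 * y) + Q / (2 * b * y)"
  define l3 where "l3 = 1 / (2 * (a * s)) * (1 + a * s * Q / (b * y))"
  define p where "p = (\<lambda>m. l1 * d1 m - d m * (a / 2 * (1 + 1 / (y * Q ^ m))))"
  define r where "r = (\<lambda>m. d m * (a / (2 * (y * Q ^ m)) + Q / (2 * b * (y * Q ^ m))) - l2 * d m)"
  define \<sigma> where "\<sigma> = (\<lambda>m. l3 * d3 m - d m * (1 / (2 * a) * (1 + a * Q / (b * (y * Q ^ m)))))"
  have p: "p m = g m * (X (Suc m) * V (Suc m))" for m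
  proof -
    have "l1 * d1 m = a * s / (2 * y) * ((1 + y) * d1 m)"
      using nz by (simp add: l1_def field_simps)
    also have "\<dots> = e m * X (Suc m) * V (Suc m) / (2 * W * y) * (a * (s * (1 - \<beta> / s)))"
      unfolding d1 by (simp add: mult_ac)
    also have "s * (1 - \<beta> / s) = s - \<beta>"
      using nz by (simp add: field_simps)
    finally have 1: "l1 * d1 m = e m * X (Suc m) * V (Suc m) / (2 * W * y) * (a * (s - \<beta>))" .
    have "d m * (a / 2 * (1 + 1 / (y * Q ^ m))) = e m * (X m * (1 + y * Q ^ m)) * V m / (2 * W * y) * (a / Q ^ m)"
      using nz by (simp add: d_def field_simps)
    also have "\<dots> = e m * X (Suc m) * V (Suc m) / (2 * W * y) * (a * (1 / Q ^ m - \<beta>))"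
      unfolding X_Suc[symmetric] V_step[of m] using nz by (simp add: field_simps)
    finally have 2: "d m * (a / 2 * (1 + 1 / (y * Q ^ m))) =
      e m * X (Suc m) * V (Suc m) / (2 * W * y) * (a * (1 / Q ^ m - \<beta>))" .
    have "p m = e m * X (Suc m) * V (Suc m) / (2 * W * y) * (a * (s - 1 / Q ^ m))"
      unfolding p_def 1 2 right_diff_distrib[symmetric] by simp
    thus ?thesis using nz W by (simp add: g_def field_simps)
  qed
  have \<sigma>: "\<sigma> m = e m * poch_inf (\<beta> * Q ^ m / Q) * Q / (2 * W * b * y) * (poch (- y / Q) m - X m / Q ^ m)" for m
  proof -
    have "l3 * d3 m = Q / (2 * b * y) * ((1 - \<beta> / s / Q) * d3 m)"
      using nz by (simp add: l3_def \<beta>_def field_simps)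
    also have "\<dots> = e m * poch_inf (\<beta> * Q ^ m / Q) * Q / (2 * W * b * y) * poch (- y / Q) m"
      unfolding d3 by (simp add: mult_ac)
    finally have 1: "l3 * d3 m = e m * poch_inf (\<beta> * Q ^ m / Q) * Q / (2 * W * b * y) * poch (- y / Q) m" .
    have "1 / (2 * a) * (1 + a * Q / (b * (y * Q ^ m))) = Q / (2 * b * y * Q ^ m) * (1 - \<beta> * Q ^ m / Q)"
      using nz by (simp add: \<beta>_def field_simps)
    hence "d m * (1 / (2 * a) * (1 + a * Q / (b * (y * Q ^ m)))) =
      e m * X m / W * (Q / (2 * b * y * Q ^ m)) * ((1 - \<beta> * Q ^ m / Q) * V m)"
      by (simp add: d_def)
    also have "\<dots> = e m * poch_inf (\<beta> * Q ^ m / Q) * Q / (2 * W * b * y) * (X m / Q ^ m)"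
      unfolding V_pred[symmetric] by (simp add: mult_ac)
    finally have 2: "d m * (1 / (2 * a) * (1 + a * Q / (b * (y * Q ^ m)))) =
      e m * poch_inf (\<beta> * Q ^ m / Q) * Q / (2 * W * b * y) * (X m / Q ^ m)" .
    show ?thesis unfolding \<sigma>_def 1 2 by (simp only: right_diff_distrib)
  qed
  have \<sigma>_Suc: "\<sigma> (Suc m) = g m * (X m * V m)" for m
  proof -
    have first: "poch (- y / Q) (Suc m) = (1 + y / Q) * X m"
      unfolding X_def by (simp add: poch_Suc_shift)
    have *: "poch (- y / Q) (Suc m) - X (Suc m) / Q ^ Suc m = - (1 - Q ^ Suc m) * X m / Q ^ Suc m"
      unfolding first X_Suc by (simp add: field_simps)
    have "poch_inf (\<beta> * Q ^ Suc m / Q) = V m" by (simp add: V_def)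
    hence "\<sigma> (Suc m) = e (Suc m) * V m * Q / (2 * W * b * y) * (- (1 - Q ^ Suc m) * X m / Q ^ Suc m)"
      unfolding \<sigma> * by (simp only:)
    also have "\<dots> = - (e (Suc m) * (1 - Q ^ Suc m)) * (V m * Q / (2 * W * b * y) * X m / Q ^ Suc m)"
      by (simp only: divide_inverse mult_minus_left mult_minus_right mult_ac)
    also have "\<dots> = g m * (X m * V m)"
      unfolding e_Suc using nz W by (simp add: g_def field_simps)
    finally show ?thesis .
  qed
  have r: "r m = e m * (a * (1 - s * Q ^ m) + Q / b * (1 - Q ^ m)) / (2 * W * y * Q ^ m) * (X m * V m)" for m
    using nz W by (simp add: r_def l2_def d_def field_simps)
  have r_Suc: "r (Suc m) = - (g (Suc m) + g m) * (X (Suc m) * V (Suc m))" for m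
  proof -
    have "e (Suc m) * (Q / b * (1 - Q ^ Suc m)) / (2 * W * y * Q ^ Suc m) = - g m"
    proof -
      have "e (Suc m) * (Q / b * (1 - Q ^ Suc m)) = (e m * (a * b * (1 - s * Q ^ m))) * (Q / b)"
        unfolding e_Suc[symmetric] by (simp only: mult_ac)
      also have "\<dots> / (2 * W * y * Q ^ Suc m) = - g m"
        using nz W by (simp add: g_def field_simps)
      finally show ?thesis .
    qed
    moreover have "e (Suc m) * (a * (1 - s * Q ^ Suc m)) / (2 * W * y * Q ^ Suc m) = - g (Suc m)"
      by (simp add: g_def)
    ultimately have "e (Suc m) * (a * (1 - s * Q ^ Suc m) + Q / b * (1 - Q ^ Suc m)) / (2 * W * y * Q ^ Suc m)
      = - (g (Suc m) + g m)"
      unfolding ring_distribs(1) add_divide_distrib by (simp del: power_Suc)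
    thus ?thesis unfolding r by (simp only:)
  qed
  have tel: "(\<lambda>j. p j * u (j + 2) + r j * u (j + 1) + \<sigma> j * u j) sums 0"
  proof (rule three_term_telescope_sums)
    show "\<sigma> 0 = 0" unfolding \<sigma> by (simp add: X_def)
    have "r 0 = - g 0 * (X 0 * V 0)" unfolding r by (simp add: g_def)
    thus "r 0 + \<sigma> 1 = 0" using \<sigma>_Suc[of 0] by simp
    show "p n + r (Suc n) + \<sigma> (n + 2) = 0" for n
      using \<sigma>_Suc[of "Suc n"] unfolding p r_Suc by (simp add: algebra_simps)
    have "p n * u (n + 2) - \<sigma> (n + 1) * u (n + 1) = 0" if "n \<ge> Suc N" for n
      using u0 that by simp
    thus "(\<lambda>n. p n * u (n + 2) - \<sigma> (n + 1) * u (n + 1)) \<longlonglongrightarrow> 0"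
      by (intro tendsto_eventually eventually_sequentiallyI[of "Suc N"])
  qed
  have termwise: "d j * L_op q a b f (y * Q ^ j) =
    l1 * (d1 j * u (j + 2)) - l2 * (d j * u (j + 1)) + l3 * (d3 j * u (j + 0))
    - (p j * u (j + 2) + r j * u (j + 1) + \<sigma> j * u j)" for j
  proof -
    have L: "L_op q a b f (y * Q ^ j) = a / 2 * (1 + 1 / (y * Q ^ j)) * u (j + 2)
      - (a / (2 * (y * Q ^ j)) + Q / (2 * b * (y * Q ^ j))) * u (j + 1)
      + 1 / (2 * a) * (1 + a * Q / (b * (y * Q ^ j))) * u j"
      by (simp add: L_op_def u_def mult_ac)
    have distrib: "D * (C1 * v2 - C2 * v1 + C3 * v0) = l1 * (D1 * v2) - l2 * (D * v1) + l3 * (D3 * v0)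
        - ((l1 * D1 - D * C1) * v2 + (D * C2 - l2 * D) * v1 + (l3 * D3 - D * C3) * v0)"
      for D D1 D3 C1 C2 C3 v0 v1 v2 :: complex
      by (simp add: algebra_simps)
    show ?thesis unfolding L p_def r_def \<sigma>_def add_0_right by (rule distrib)
  qed
  have "(\<lambda>j. d j * L_op q a b f (y * Q ^ j)) sums
    (l1 * (\<Sum>j. d1 j * u (j + 2)) - l2 * (\<Sum>j. d j * u (j + 1)) + l3 * (\<Sum>j. d3 j * u (j + 0)) - 0)"
    unfolding termwise by (intro sums_add sums_diff sums_mult summable_sums summ tel)
  thus ?thesis
    by (simp add: sums_iff L_op_def[of q "a * s"] A l1_def l2_def l3_def A_nu_def[of s a b "L_op q a b f"] d)
qed

section \<open>Eigenfunctions\<close>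

text \<open>Euler's transformation at \<open>-byq\<^sup>m/a\<close> has the factor \<open>(-yq\<^sup>m)\<^sub>\<infinity>\<close>, which \<open>(-y)\<^sub>m\<close>
completes to the constant \<open>(-y)\<^sub>\<infinity>\<close>. What remains is \<open>heine_cont_binomial_sum\<close> at \<open>-y\<close> with parameters
\<open>b/\<sigma>, b\<sigma>\<close>, and Euler's transformation for \<open>as\<close> in place of \<open>a\<close> leads back.\<close>

lemma A_nu_eigenfunction:
  assumes nz: "a \<noteq> 0" "b \<noteq> 0" "s \<noteq> 0" "\<sigma> \<noteq> 0"
    and ab: "norm (a * b) < 1" "norm (a * b * s) < 1"
    and np: "- y \<notin> poles" "- b * y / a \<notin> poles" "- b * y / (a * s) \<notin> poles"
  shows "(\<lambda>m. nu_kernel s a b y m * heine_cont (a * \<sigma>) (a / \<sigma>) (a * b) (- b * (y * Q ^ m) / a)) sums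
    heine_cont (a * s * \<sigma>) (a * s / \<sigma>) (a * b * s) (- b * y / (a * s))"
proof -
  define z where "z = - b * y / a"
  have zs: "- b * y / (a * s) = z / s" by (simp add: z_def)
  have W: "poch_inf (z / s) \<noteq> 0" using np(3) unfolding zs by (simp add: poch_inf_eq_0_iff)
  have y: "poch_inf (- y) = poch (- y) m * poch_inf (- y * Q ^ m)" for m
    by (rule poch_inf_split)
  have termwise: "nu_kernel s a b y m * heine_cont (a * \<sigma>) (a / \<sigma>) (a * b) (- b * (y * Q ^ m) / a) =
    poch_inf (- y) / poch_inf (z / s) *
    (binom_coeff s m * (a * b) ^ m * heine_cont (b / \<sigma>) (b * \<sigma>) (a * b) (- y * Q ^ m))" for m
  proof -
    have k: "a * \<sigma> * (a / \<sigma>) / (a * b) * (z * Q ^ m) = - y * Q ^ m" "a * b / (a * \<sigma>) = b / \<sigma>" "a * b / (a / \<sigma>) = b * \<sigma>"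
      "- b * (y * Q ^ m) / a = z * Q ^ m" "- b * y / a * Q ^ m = z * Q ^ m"
      using nz by (simp_all add: z_def field_simps)
    have "poch_inf (z * Q ^ m) * heine_cont (a * \<sigma>) (a / \<sigma>) (a * b) (z * Q ^ m) =
      poch_inf (- y * Q ^ m) * heine_cont (b / \<sigma>) (b * \<sigma>) (a * b) (- y * Q ^ m)"
      using heine_euler_transformation[of "a * \<sigma>" "a / \<sigma>" "a * b" "z * Q ^ m"] nz
        norm_less_1_notin_poles[OF ab(1)] mult_Q_power_notin_poles[OF np(1), of m]
        mult_Q_power_notin_poles[OF np(2), of m]
      unfolding k by (simp add: z_def)
    thus ?thesis
      unfolding nu_kernel_def zs k y[of m] by (simp add: mult_ac)
  qed
  have "(\<lambda>m. poch_inf (- y) / poch_inf (z / s) *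
    (binom_coeff s m * (a * b) ^ m * heine_cont (b / \<sigma>) (b * \<sigma>) (a * b) (- y * Q ^ m))) sums
    (poch_inf (- y) / poch_inf (z / s) * heine_cont (b / \<sigma>) (b * \<sigma>) (a * b * s) (- y))"
    by (intro sums_mult heine_cont_binomial_sum ab np)
  moreover have "poch_inf (- y) * heine_cont (b / \<sigma>) (b * \<sigma>) (a * b * s) (- y) =
    poch_inf (z / s) * heine_cont (a * s * \<sigma>) (a * s / \<sigma>) (a * b * s) (z / s)"
  proof -
    have k: "a * s * \<sigma> * (a * s / \<sigma>) / (a * b * s) * (z / s) = - y" "a * b * s / (a * s * \<sigma>) = b / \<sigma>"
      "a * b * s / (a * s / \<sigma>) = b * \<sigma>"
      using nz by (simp_all add: z_def field_simps)
    show ?thesis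
      using heine_euler_transformation[of "a * s * \<sigma>" "a * s / \<sigma>" "a * b * s" "z / s"] nz
        norm_less_1_notin_poles[OF ab(2)] np unfolding k zs by simp
  qed
  ultimately show ?thesis unfolding termwise zs using W by simp
qed

section \<open>Admissible points and orbits\<close>

text \<open>The excluded set for admissible points consists of all integer powers of \<open>q\<close>, because it
must be invariant under \<open>x \<mapsto> qx\<close> and \<open>x \<mapsto> x/q\<close>, which occur in the difference operator.\<close>

lemma poles_subset_int_powers: "poles \<subseteq> q_int_powers q"
proof
  fix w assume "w \<in> poles"
  then obtain j :: nat where "w = 1 / Q ^ j" unfolding q_neg_powers_def by auto
  hence "w = Q powi (- int j)" by (simp add: power_int_minus field_simps)
  thus "w \<in> q_int_powers q" unfolding q_int_powers_def by blast
qed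

lemma int_powers_mult_powi:
  "w * Q powi n \<in> q_int_powers q \<longleftrightarrow> w \<in> q_int_powers q"
proof
  assume "w \<in> q_int_powers q"
  then obtain k where "w = Q powi k" unfolding q_int_powers_def by auto
  hence "w * Q powi n = Q powi (k + n)" by (simp add: power_int_add)
  thus "w * Q powi n \<in> q_int_powers q" unfolding q_int_powers_def by blast
next
  assume "w * Q powi n \<in> q_int_powers q"
  then obtain k where "w * Q powi n = Q powi k" unfolding q_int_powers_def by auto
  hence "w = Q powi (k - n)" by (simp add: power_int_diff field_simps)
  thus "w \<in> q_int_powers q" unfolding q_int_powers_def by blast
qed

lemma not_int_power_imp_not_pole: "w \<notin> q_int_powers q \<Longrightarrow> w * Q powi n \<notin> poles"
  using poles_subset_int_powers int_powers_mult_powi by blast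

text \<open>The poles are the zeros of the entire function \<open>(x)\<^sub>\<infinity>\<close>, which is not identically \<open>0\<close>.\<close>

lemma eventually_not_pole: "eventually (\<lambda>w. w \<notin> poles) (at z)"
proof -
  have "\<not> z islimpt poles"
  proof
    assume "z islimpt poles"
    hence "poch_inf 0 = 0"
      using analytic_continuation[OF poch_inf_holomorphic open_UNIV connected_UNIV, of poles z 0]
      by (simp add: poch_inf_eq_0_iff)
    thus False by simp
  qed
  thus ?thesis by (simp add: islimpt_iff_eventually)
qed

text \<open>The continuation with the factor \<open>(ab)\<^sub>\<infinity>\<close> is continuous in \<open>b\<close>, and the exceptional
values of \<open>ab\<close> are isolated. So the limit in the definition is the value of the same formula.\<close>

lemma normalized_little_q_jacobi_eq:
  fixes lam :: complex
  assumes "a \<noteq> 0" and z: "- b * x / a \<notin> poles"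
  defines "\<sigma> \<equiv> SOME \<sigma>. \<sigma> \<noteq> 0 \<and> lam = (\<sigma> + 1 / \<sigma>) / 2"
  shows "normalized_little_q_jacobi q lam a b x = heine_cont (a * \<sigma>) (a / \<sigma>) (a * b) (- b * x / a)"
proof -
  have eq: "poch_inf (a * b') * little_q_jacobi q lam a b' x =
      heine_cont (a * \<sigma>) (a / \<sigma>) (a * b') (- b' * x / a)"
    if "a * b' \<notin> poles" "- b' * x / a \<notin> poles" for b'
    using that by (simp add: little_q_jacobi_def Let_def \<sigma>_def phi21_eq_heine_cont poch_inf_eq_0_iff)
  show ?thesis
  proof (cases "a * b \<in> poles")
    case False
    thus ?thesis unfolding normalized_little_q_jacobi_def using eq z by simp
  next
    case True
    have "filterlim (\<lambda>b'. a * b') (at (a * b)) (at b)"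
      unfolding filterlim_at using assms(1)
      by (auto intro!: tendsto_intros simp: eventually_at_filter)
    from filterlim_iff[THEN iffD1, OF this, rule_format, OF eventually_not_pole]
    have ev1: "eventually (\<lambda>b'. a * b' \<notin> poles) (at b)" .
    have "((\<lambda>b'. - b' * x / a) \<longlongrightarrow> - b * x / a) (at b)"
      using assms(1) by (intro tendsto_intros) auto
    hence ev2: "eventually (\<lambda>b'. - b' * x / a \<in> - poles) (at b)"
      using open_Compl_poles z by (intro topological_tendstoD) auto
    have "((\<lambda>b'. (a * b', - b' * x / a)) \<longlongrightarrow> (a * b, - b * x / a)) (at b)"
      using assms(1) by (intro tendsto_intros) auto
    from isCont_tendsto_compose[OF heine_cont_jointly_continuous[OF z] this]
    have "((\<lambda>b'. heine_cont (a * \<sigma>) (a / \<sigma>) (a * b') (- b' * x / a)) \<longlongrightarrow>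
      heine_cont (a * \<sigma>) (a / \<sigma>) (a * b) (- b * x / a)) (at b)" by simp
    moreover have "eventually (\<lambda>b'. poch_inf (a * b') * little_q_jacobi q lam a b' x =
      heine_cont (a * \<sigma>) (a / \<sigma>) (a * b') (- b' * x / a)) (at b)"
      using ev1 ev2 by eventually_elim (use eq in auto)
    ultimately have "((\<lambda>b'. poch_inf (a * b') * little_q_jacobi q lam a b' x) \<longlongrightarrow>
      heine_cont (a * \<sigma>) (a / \<sigma>) (a * b) (- b * x / a)) (at b)"
      by (subst tendsto_cong)
    hence "Lim (at b) (\<lambda>b'. poch_inf (a * b') * little_q_jacobi q lam a b' x) =
      heine_cont (a * \<sigma>) (a / \<sigma>) (a * b) (- b * x / a)"
      by (rule tendsto_Lim[OF trivial_limit_at])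
    thus ?thesis unfolding normalized_little_q_jacobi_def using True by simp
  qed
qed

text \<open>A compact set that avoids \<open>0\<close> avoids a neighbourhood of \<open>0\<close>.\<close>

lemma compact_support_vanishes_on_orbit:
  assumes "compactly_supported_pos f" and "y \<noteq> 0"
  shows "\<exists>N. \<forall>n\<ge>N. f (y * Q ^ n) = 0"
proof -
  obtain K where K: "compact K" "K \<subseteq> complex_of_real ` {0<..}" "\<forall>z. z \<noteq> 0 \<and> z \<notin> K \<longrightarrow> f z = 0"
    using assms(1) unfolding compactly_supported_pos_def by blast
  have "open (- K)" using compact_imp_closed[OF K(1)] by (rule open_Compl)
  moreover have "0 \<in> - K" using K(2) by auto
  moreover have "(\<lambda>n. y * Q ^ n) \<longlonglongrightarrow> 0"
    using tendsto_mult[OF tendsto_const Q_powers_tendsto_0] by simp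
  ultimately have "eventually (\<lambda>n. y * Q ^ n \<in> - K) sequentially"
    by (rule topological_tendstoD[rotated])
  then obtain N where N: "\<And>n. n \<ge> N \<Longrightarrow> y * Q ^ n \<notin> K"
    by (auto simp: eventually_sequentially)
  have "f (y * Q ^ n) = 0" if "n \<ge> N" for n
    using assms(2) K(3) N[OF that] by simp
  thus ?thesis by blast
qed

end

theorem theorem6p6:
  fixes q a b \<nu> :: real and \<mu> :: complex
  assumes "0 < q" and "q < 1" and "a > 0" and "b > 0" and "a * b < 1"
    and "\<nu> > 0" and "\<mu> \<notin> \<int>\<^sub>\<le>\<^sub>0"
  shows "\<forall>x \<in> admissible_points q \<nu> \<mu> a b.
      (\<forall>f. bounded (f ` (- {0})) \<longrightarrow> summable (A_summand q \<nu> \<mu> a b f x)) \<and>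
      (\<forall>f. compactly_supported_pos f \<longrightarrow>
         (L_op q (of_real a * of_real q powr of_real \<nu>) (of_real b * of_real q powr \<mu>)
            \<circ> A_op q \<nu> \<mu> a b) f x
         = (A_op q \<nu> \<mu> a b \<circ> L_op q (of_real a) (of_real b)) f x) \<and>
      (\<forall>lam.
         summable (A_summand q \<nu> \<mu> a b (little_q_jacobi q lam (of_real a) (of_real b)) x) \<and>
         A_op q \<nu> \<mu> a b (little_q_jacobi q lam (of_real a) (of_real b)) x
         = normalized_little_q_jacobi q lam
             (of_real a * of_real q powr of_real \<nu>) (of_real b * of_real q powr \<mu>) x
           / qpoch_inf (of_real (a * b)) q)"
proof
  interpret q_base q using assms by unfold_locales auto
  define s where "s = Q powr of_real \<nu>"
  define t where "t = Q powr \<mu>"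
  define ca where "ca = complex_of_real a"
  define cb where "cb = complex_of_real b"
  have nz: "ca \<noteq> 0" "cb \<noteq> 0" "t \<noteq> 0" "s \<noteq> 0"
    using assms by (auto simp: ca_def cb_def s_def t_def)
  have s_real: "s = of_real (q powr \<nu>)" using q_pos by (simp add: s_def powr_of_real)
  have s01: "0 < q powr \<nu>" "q powr \<nu> < 1"
    using assms powr_less_mono'[of q 0 \<nu>] by auto
  have ab: "norm (ca * cb) < 1" using assms by (simp add: ca_def cb_def norm_mult)
  have abs: "norm (ca * cb * s) < 1"
  proof -
    have "(a * b) * q powr \<nu> < 1 * 1"
      using assms s01 by (intro mult_strict_mono) auto
    thus ?thesis using assms s01 by (simp add: ca_def cb_def s_real norm_mult)
  qed
  have s_np: "s \<notin> poles" using s01 by (intro norm_less_1_notin_poles) (simp add: s_real)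
  have pw: "Q powr (\<mu> - of_real \<nu>) = t / s" "Q powr (\<mu> + of_nat k) = t * Q ^ k"
    "Q powr (1 - of_real \<nu> - of_nat k) = Q / (s * Q ^ k)" for k
    by (simp_all add: s_def t_def powr_diff powr_add powr_nat')
  have summand: "A_summand q \<nu> \<mu> a b f x = (\<lambda>k. f (x * t * Q ^ k) * (ca * cb) ^ k * (poch s k * poch (- x * t) k)
      / (poch Q k * poch (- cb * x * t / ca) k)
      * phi32 q k t (- cb * x * t / (ca * s)) (Q / (s * Q ^ k)) (- x * t))" for f x
    unfolding A_summand_def pw
    by (rule ext) (simp add: s_def[symmetric] t_def[symmetric] ca_def cb_def mult_ac)
  have A_op: "A_op q \<nu> \<mu> a b f x = poch_inf (- cb * x * t / ca) / poch_inf (- cb * x * t / (ca * s))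
    * (\<Sum>k. A_summand q \<nu> \<mu> a b f x k)" for f x
    unfolding A_op_def pw by (simp add: t_def[symmetric] ca_def cb_def mult_ac)
  have adm: "x \<in> admissible_points q \<nu> \<mu> a b \<longleftrightarrow> x \<noteq> 0 \<and> - x * t \<notin> q_int_powers q \<and>
      - cb * x * t / ca \<notin> q_int_powers q \<and> - cb * x * t / (ca * s) \<notin> q_int_powers q" for x
    unfolding admissible_points_def pw by (simp add: t_def[symmetric] ca_def cb_def mult_ac)
  have adm_powi: "x * Q powi n \<in> admissible_points q \<nu> \<mu> a b"
    if "x \<in> admissible_points q \<nu> \<mu> a b" for x n
  proof -
    have e: "- (x * Q powi n) * t = (- x * t) * Q powi n"
      "- cb * (x * Q powi n) * t / ca = (- cb * x * t / ca) * Q powi n"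
      "- cb * (x * Q powi n) * t / (ca * s) = (- cb * x * t / (ca * s)) * Q powi n"
      by simp_all
    show ?thesis using that unfolding adm e int_powers_mult_powi by simp
  qed
  have np: "- x * t * Q powi n \<notin> poles" "- cb * x * t / ca * Q powi n \<notin> poles"
    "- cb * x * t / (ca * s) * Q powi n \<notin> poles" "x \<noteq> 0"
    if "x \<in> admissible_points q \<nu> \<mu> a b" for x n
    using that not_int_power_imp_not_pole unfolding adm by blast+
  have np0: "- x * t \<notin> poles" "- cb * x * t / ca \<notin> poles" "- cb * x * t / (ca * s) \<notin> poles"
    if "x \<in> admissible_points q \<nu> \<mu> a b" for x
    using np(1-3)[OF that, of 0] by simp_all
  have fact: "summable (A_summand q \<nu> \<mu> a b f x)"
      "A_op q \<nu> \<mu> a b f x = A_mu t (ca * cb * s) (A_nu s ca cb f) x"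
    if x: "x \<in> admissible_points q \<nu> \<mu> a b" and F: "\<exists>F. \<forall>k. norm (f (x * t * Q ^ k)) \<le> F" for f x
  proof -
    obtain F where F: "\<And>k. norm (f (x * t * Q ^ k)) \<le> F" using F by auto
    note * = A_factorization[where f = f and x = x and t = t and a = ca and b = cb and s = s, OF nz(4) s_np ab abs np0[OF x] F]
    show "summable (A_summand q \<nu> \<mu> a b f x)" unfolding summand by (rule *(1))
    show "A_op q \<nu> \<mu> a b f x = A_mu t (ca * cb * s) (A_nu s ca cb f) x"
      unfolding A_op summand by (rule *(2))
  qed
  fix x assume x: "x \<in> admissible_points q \<nu> \<mu> a b"
  have x0: "x \<noteq> 0" using np(4)[OF x] .
  show "(\<forall>f. bounded (f ` (- {0})) \<longrightarrow> summable (A_summand q \<nu> \<mu> a b f x)) \<and>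
      (\<forall>f. compactly_supported_pos f \<longrightarrow>
         (L_op q (of_real a * of_real q powr of_real \<nu>) (of_real b * of_real q powr \<mu>)
            \<circ> A_op q \<nu> \<mu> a b) f x
         = (A_op q \<nu> \<mu> a b \<circ> L_op q (of_real a) (of_real b)) f x) \<and>
      (\<forall>lam.
         summable (A_summand q \<nu> \<mu> a b (little_q_jacobi q lam (of_real a) (of_real b)) x) \<and>
         A_op q \<nu> \<mu> a b (little_q_jacobi q lam (of_real a) (of_real b)) x
         = normalized_little_q_jacobi q lam
             (of_real a * of_real q powr of_real \<nu>) (of_real b * of_real q powr \<mu>) x
           / qpoch_inf (of_real (a * b)) q)"
  proof (intro conjI allI impI)
    fix f :: "complex \<Rightarrow> complex" assume "bounded (f ` (- {0}))"
    then obtain F where "\<forall>w \<in> f ` (- {0}). norm w \<le> F" by (auto simp: bounded_iff)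
    moreover have "x * t * Q ^ k \<in> - {0}" for k using x0 nz by simp
    ultimately have "\<forall>k. norm (f (x * t * Q ^ k)) \<le> F" by blast
    thus "summable (A_summand q \<nu> \<mu> a b f x)" using fact(1)[OF x] by blast
  next
    fix f assume f: "compactly_supported_pos f"
    define g where "g = L_op q ca cb f"
    have f_zero: "\<exists>N. \<forall>n\<ge>N. f (y * Q ^ n) = 0" if "y \<noteq> 0" for y
      using f that by (rule compact_support_vanishes_on_orbit)
    have g_zero: "\<exists>N. \<forall>n\<ge>N. g (y * Q ^ n) = 0" if y: "y \<noteq> 0" for y
    proof -
      obtain N where N: "\<And>n. n \<ge> N \<Longrightarrow> f (y / Q * Q ^ n) = 0"
        using f_zero[of "y / Q"] y by auto
      have "g (y * Q ^ n) = 0" if "n \<ge> N" for n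
      proof -
        have e: "y * Q ^ n / Q = y / Q * Q ^ n" "y * Q ^ n = y / Q * Q ^ (n + 1)"
          "Q * (y * Q ^ n) = y / Q * Q ^ (n + 2)" by simp_all
        have "f (y * Q ^ n / Q) = 0" unfolding e(1) using that by (rule N)
        moreover have "f (y * Q ^ n) = 0" by (subst e(2), rule N) (use that in simp)
        moreover have "f (Q * (y * Q ^ n)) = 0" by (subst e(3), rule N) (use that in simp)
        ultimately show ?thesis unfolding g_def L_op_def by (simp only: mult_zero_right) simp
      qed
      thus ?thesis by blast
    qed
    have A_f: "A_op q \<nu> \<mu> a b f y = A_mu t (ca * cb * s) (A_nu s ca cb f) y"
      if y: "y \<in> admissible_points q \<nu> \<mu> a b" for y
    proof (rule fact(2)[OF y], rule eventually_zero_bounded)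
      show "\<exists>N. \<forall>n\<ge>N. f (y * t * Q ^ n) = 0" using f_zero[of "y * t"] np(4)[OF y] nz by simp
    qed
    have A_g: "A_op q \<nu> \<mu> a b g x = A_mu t (ca * cb * s) (A_nu s ca cb g) x"
    proof (rule fact(2)[OF x], rule eventually_zero_bounded)
      show "\<exists>N. \<forall>n\<ge>N. g (x * t * Q ^ n) = 0" using g_zero[of "x * t"] x0 nz by simp
    qed
    obtain N where N: "\<And>n. n \<ge> N \<Longrightarrow> f (x * t * Q ^ n) = 0"
      using f_zero[of "x * t"] x0 nz by auto
    have nu_zero: "A_nu s ca cb f (x * t * Q ^ n) = 0" if "n \<ge> N" for n
    proof -
      have "f (x * t * Q ^ n * Q ^ m) = 0" for m
        using N[of "n + m"] that by (simp add: power_add mult.assoc)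
      thus ?thesis by (simp add: A_nu_def)
    qed
    have nu_L: "L_op q (ca * s) cb (A_nu s ca cb f) (x * t * Q ^ j) = A_nu s ca cb g (x * t * Q ^ j)" for j
      unfolding g_def
    proof (rule A_nu_intertwines)
      have "- cb * (x * t * Q ^ j) / (ca * s) / Q = - cb * x * t / (ca * s) * Q powi (int j - 1)"
        by (simp add: power_int_diff)
      thus "- cb * (x * t * Q ^ j) / (ca * s) / Q \<notin> poles" using np(3)[OF x] by simp
      show "f (x * t * Q ^ j * Q ^ n) = 0" if "n \<ge> N" for n
        using N[of "j + n"] that by (simp add: power_add mult.assoc)
    qed (use x0 nz in auto)
    \<comment> \<open>the outer difference operator evaluates \<open>A f\<close> at \<open>qx\<close>, \<open>x\<close> and \<open>x/q\<close>, all of them admissible\<close>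
    have "Q * x = x * Q powi 1" "x / Q = x * Q powi (- 1)"
      by (simp_all add: power_int_minus divide_inverse)
    hence "A_op q \<nu> \<mu> a b f (Q * x) = A_mu t (ca * cb * s) (A_nu s ca cb f) (Q * x)"
      "A_op q \<nu> \<mu> a b f (x / Q) = A_mu t (ca * cb * s) (A_nu s ca cb f) (x / Q)"
      using A_f[OF adm_powi[OF x, of 1]] A_f[OF adm_powi[OF x, of "- 1"]] by (simp_all only:)
    hence "L_op q (ca * s) (cb * t) (A_op q \<nu> \<mu> a b f) x =
      L_op q (ca * s) (cb * t) (A_mu t (ca * cb * s) (A_nu s ca cb f)) x"
      unfolding L_op_def using A_f[OF x] by (simp only:)
    also have "\<dots> = A_mu t (ca * cb * s) (L_op q (ca * s) cb (A_nu s ca cb f)) x"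
      using A_mu_intertwines[of x t "ca * s" cb N "A_nu s ca cb f"] x0 nz nu_zero
      by (simp add: mult_ac)
    also have "\<dots> = A_mu t (ca * cb * s) (A_nu s ca cb g) x"
      unfolding A_mu_def nu_L ..
    also have "\<dots> = A_op q \<nu> \<mu> a b g x" by (rule A_g[symmetric])
    finally show "(L_op q (of_real a * of_real q powr of_real \<nu>) (of_real b * of_real q powr \<mu>)
            \<circ> A_op q \<nu> \<mu> a b) f x
         = (A_op q \<nu> \<mu> a b \<circ> L_op q (of_real a) (of_real b)) f x"
      by (simp add: g_def ca_def cb_def s_def t_def)
  next
    fix lam
    define \<sigma> where "\<sigma> = (SOME \<sigma>::complex. \<sigma> \<noteq> 0 \<and> lam = (\<sigma> + 1 / \<sigma>) / 2)"
    have \<sigma>: "\<sigma> \<noteq> 0"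
      using someI_ex[OF joukowski_parameter_exists[of lam]] unfolding \<sigma>_def by simp
    define f where "f = little_q_jacobi q lam ca cb"
    define C where "C = heine_cont (ca * \<sigma>) (ca / \<sigma>) (ca * cb)"
    define C' where "C' = heine_cont (ca * s * \<sigma>) (ca * s / \<sigma>)"
    have ab_np: "ca * cb \<notin> poles" using ab by (rule norm_less_1_notin_poles)
    have ab_nz: "poch_inf (ca * cb) \<noteq> 0" using ab_np poch_inf_eq_0_iff by blast
    have f_orbit: "f (x * t * Q ^ k) = C (- cb * x * t / ca * Q ^ k) / poch_inf (ca * cb)" for k
    proof -
      have arg: "- cb * (x * t * Q ^ k) / ca = - cb * x * t / ca * Q ^ k" by simp
      show ?thesis
        unfolding f_def little_q_jacobi_def Let_def \<sigma>_def[symmetric] C_def arg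
        by (rule phi21_eq_heine_cont[OF ab_np mult_Q_power_notin_poles[OF np0(2)[OF x]]])
    qed
    have f_bounded: "\<exists>F. \<forall>k. norm (f (x * t * Q ^ k)) \<le> F"
    proof -
      obtain M where M: "\<And>k. norm (C (- cb * x * t / ca * Q ^ k)) \<le> M"
        unfolding C_def using heine_cont_orbit_bounded by blast
      have "norm (f (x * t * Q ^ k)) \<le> M / norm (poch_inf (ca * cb))" for k
        unfolding f_orbit norm_divide using M by (intro divide_right_mono) auto
      thus ?thesis by blast
    qed
    show "summable (A_summand q \<nu> \<mu> a b (little_q_jacobi q lam (of_real a) (of_real b)) x)"
      using fact(1)[OF x f_bounded] by (simp add: f_def ca_def cb_def)
    have nu: "A_nu s ca cb f (x * t * Q ^ j) =
      C' (ca * cb * s) (- cb * x * t / (ca * s) * Q ^ j) / poch_inf (ca * cb)" for j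
    proof -
      have y: "- (x * t * Q ^ j) \<notin> poles" "- cb * (x * t * Q ^ j) / ca \<notin> poles"
        "- cb * (x * t * Q ^ j) / (ca * s) \<notin> poles"
        using np(1-3)[OF x, of "int j"] by (simp_all add: mult.assoc)
      have "(\<lambda>m. nu_kernel s ca cb (x * t * Q ^ j) m * C (- cb * (x * t * Q ^ j * Q ^ m) / ca) / poch_inf (ca * cb))
        sums (C' (ca * cb * s) (- cb * (x * t * Q ^ j) / (ca * s)) / poch_inf (ca * cb))"
        unfolding C_def C'_def by (intro sums_divide A_nu_eigenfunction nz \<sigma> ab abs y)
      moreover have "nu_kernel s ca cb (x * t * Q ^ j) m * C (- cb * (x * t * Q ^ j * Q ^ m) / ca) / poch_inf (ca * cb) =
        nu_kernel s ca cb (x * t * Q ^ j) m * f (x * t * Q ^ j * Q ^ m)" for m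
      proof -
        have "- cb * (x * t * Q ^ j * Q ^ m) / ca = - cb * x * t / ca * Q ^ (j + m)"
          "x * t * Q ^ j * Q ^ m = x * t * Q ^ (j + m)" by (simp_all add: power_add)
        thus ?thesis using f_orbit[of "j + m"] by (simp only: times_divide_eq_right)
      qed
      moreover have "- cb * (x * t * Q ^ j) / (ca * s) = - cb * x * t / (ca * s) * Q ^ j" by simp
      ultimately have "(\<lambda>m. nu_kernel s ca cb (x * t * Q ^ j) m * f (x * t * Q ^ j * Q ^ m)) sums
        (C' (ca * cb * s) (- cb * x * t / (ca * s) * Q ^ j) / poch_inf (ca * cb))"
        by (simp only:)
      thus ?thesis unfolding A_nu_def by (rule sums_unique[symmetric])
    qed
    have "A_op q \<nu> \<mu> a b f x = A_mu t (ca * cb * s) (A_nu s ca cb f) x"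
      by (rule fact(2)[OF x f_bounded])
    also have "\<dots> = (\<Sum>j. binom_coeff t j * (ca * cb * s) ^ j *
      C' (ca * cb * s) (- cb * x * t / (ca * s) * Q ^ j) / poch_inf (ca * cb))"
      unfolding A_mu_def nu by simp
    also have "\<dots> = C' (ca * cb * s * t) (- cb * x * t / (ca * s)) / poch_inf (ca * cb)"
      unfolding C'_def
      by (rule sums_unique[symmetric]) (intro sums_divide heine_cont_binomial_sum abs np0[OF x])
    also have "C' (ca * cb * s * t) (- cb * x * t / (ca * s)) =
      normalized_little_q_jacobi q lam (ca * s) (cb * t) x"
    proof -
      have e: "ca * s * (cb * t) = ca * cb * s * t" "- (cb * t) * x / (ca * s) = - cb * x * t / (ca * s)"
        by simp_all
      show ?thesis
        using normalized_little_q_jacobi_eq[of "ca * s" "cb * t" x lam] nz np0(3)[OF x]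
        unfolding e \<sigma>_def[symmetric] C'_def by simp
    qed
    finally show "A_op q \<nu> \<mu> a b (little_q_jacobi q lam (of_real a) (of_real b)) x
         = normalized_little_q_jacobi q lam
             (of_real a * of_real q powr of_real \<nu>) (of_real b * of_real q powr \<mu>) x
           / qpoch_inf (of_real (a * b)) q"
      by (simp add: f_def ca_def cb_def s_def t_def)
  qed
qed

end
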